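(* Let $\mathbb X$ be a virtual equipment and let $j\colon A\to E$ be a tight-cell. If $j$ is dense and $r\colon C\to E$ is a right $j$-adjoint (i.e. there is a relative adjunction $\ell\dashv_j r$ for some tight-cell $\ell\colon A\to C$), then $r$ preserves (weighted) limits.
   Context: Virtual equipments. A virtual double category has objects; a category of tight-cells $f\colon A\to B$ (the composite of $f\colon A\to B$ and $g\colon B\to C$ is $gf$); loose-cells $p\colon A\nrightarrow B$; and 2-cells, each having as frame a chain of loose-cells $p_1\colon A_1\nrightarrow A_0,\dots,p_n\colon A_n\nrightarrow A_{n-1}$ ($n\ge 0$; chains are always listed in this order, and called a chain from $A_n$ to $A_0$), a loose-cell $q\colon B_n\nrightarrow B_0$, and tight-cells $f_0\colon A_0\to B_0$ (left) and $f_n\colon A_n\to B_n$ (right); 2-cells have identities and associative unital multicategory-style composition. $\phi\colon p_1,\dots,p_n\Rightarrow q$ denotes a 2-cell whose tight-cells are identities; $(\phi_1,\dots,\phi_n)$ denotes juxtaposition (followed by the opcartesian 2-cell when the codomains have a composite). A 2-cell $q_1,\dots,q_m\Rightarrow q$ is opcartesian if every 2-cell (with any tight-cells) with domain $p_1,\dots,p_l,q_1,\dots,q_m,r_1,\dots,r_n$ factors uniquely through it; then $q$ is the loose-composite $q_1\odot\cdots\odot q_m$ (the loose-identity $A(1,1)\colon A\nrightarrow A$ if $m=0$). A unary 2-cell from $p$ to $q$ with left $f$ and right $g$ is cartesian if every 2-cell into $q$ with left $ff'$ and right $gg'$ factors uniquely through it via a 2-cell with left $f'$ and right $g'$; then $p$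 is the restriction $q(f,g)$. A virtual equipment has all loose-identities and restrictions. Write $E(f,g):=E(1,1)(f,g)$; for $f\colon D\to E$, $g\colon A\to E$ it is a loose-cell $A\nrightarrow D$. The canonical isomorphisms $q(f,g)\cong C(f,1)\odot q\odot B(1,g)$ are used implicitly. For $f\colon A\to B$, $\frown_f\colon ()\Rightarrow B(f,f)$ (corresponding to the identity of $f$) and $\smile_f\colon B(1,f),B(f,1)\Rightarrow B(1,1)$ are the canonical 2-cells. $\phi(f,g)$ denotes the 2-cell obtained from $\phi$ by restricting along $f$ on the left and $g$ on the right; e.g. $\smile_c(x,y)\colon E(x,c),E(c,y)\Rightarrow E(x,y)$ is composition and $\frown_g(x,y)\colon X(x,y)\Rightarrow X'(gx,gy)$ is the action of $g\colon X\to X'$. Relative adjunction. $\ell\dashv_j r$ consists of tight-cells $j\colon A\to E$, $\ell\colon A\to C$, $r\colon C\to E$ and an isomorphism $C(\ell,1)\cong E(j,r)$ of loose-cells $C\nrightarrow A$. Density. $j\colon A\to E$ is dense if $1_j$ exhibits $1_E$ as the pointwise left extension of $j$ along $j$; explicitly, if for every chain $r_1,\dots,r_n$ ($n\ge0$) from $E$ to $E$, the assignment sending $\phi\colon r_1,\dots,r_n\Rightarrow E(1,1)$ to $(1_{E(j,1)},\phi)\colon E(j,1),r_1,\dots,r_n\Rightarrow E(j,1)$ is a bijection; and more generally for chains from an arbitrary object $X$ to $E$: 2-cells $r_1,\dots,r_n\Rightarrow E(1,1)$ must have $X=E$, so this is the condition that $E(1,1)$ is the right lift of $E(j,1)$ through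 $E(j,1)$. Weighted limits. For loose-cells $p\colon X\nrightarrow Y$ and $q\colon X\nrightarrow Z$, a right extension of $q$ along $p$ is a loose-cell $s\colon Y\nrightarrow Z$ with a 2-cell $\varpi\colon s,p\Rightarrow q$ such that every 2-cell $r_1,\dots,r_n,p\Rightarrow q$ ($n\ge0$) factors uniquely as $\varpi\circ(\psi,1_p)$ with $\psi\colon r_1,\dots,r_n\Rightarrow s$. For a loose-cell $p\colon Z\nrightarrow Y$ and a tight-cell $f\colon Z\to X$, a $p$-cone for $f$ is a pair of a tight-cell $c\colon Y\to X$ and a 2-cell $\mu\colon p\Rightarrow X(c,f)$. It is limiting (is the $p$-limit of $f$) when the 2-cell $X(1,c),p\Rightarrow X(1,f)$ given by $(1,\mu)$ followed by $\smile_c(1,f)$ exhibits $X(1,c)$ as the right extension of $X(1,f)$ along $p$. A tight-cell $g\colon X\to X'$ preserves the $p$-limit $(c,\mu)$ of $f$ when the $p$-cone $(gc,\ \frown_g(c,f)\circ\mu\colon p\Rightarrow X'(gc,gf))$ is the $p$-limit of $gf$. *)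

theory Defs
  imports Main
begin

section \<open>Virtual double categories\<close>

text \<open>
  A loose-cell p with ldom p = A and lcod p = B is p : A -|-> B. The list src \<phi> = [p1, ..., pn]
  is the domain of the 2-cell \<phi>, where pi : Ai -|-> A(i-1); so left \<phi> has domain A0, the
  codomain of p1, and right \<phi> has domain An, the domain of pn.

  In ccomp X \<psi> f [\<phi>1, ..., \<phi>n] the extra argument f is the left tight-cell of \<phi>1. It is
  redundant unless n = 0: there it supplies the degenerate path of 2-cells at f, along which a
  nullary 2-cell \<psi> with tight-cells g, g' is composed to give a nullary 2-cell with tight-cells
  g f and g' f.
\<close>

record ('o, 't, 'l, 'c) vdc =
  Obj :: "'o set"
  Tight :: "'t set"
  tdom :: "'t \<Rightarrow> 'o"
  tcod :: "'t \<Rightarrow> 'o"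
  tid :: "'o \<Rightarrow> 't"
  tcomp :: "'t \<Rightarrow> 't \<Rightarrow> 't"   \<comment> \<open>tcomp X g f is the composite of f followed by g\<close>
  Loose :: "'l set"
  ldom :: "'l \<Rightarrow> 'o"
  lcod :: "'l \<Rightarrow> 'o"
  Cell :: "'c set"
  src :: "'c \<Rightarrow> 'l list"
  tgt :: "'c \<Rightarrow> 'l"
  left :: "'c \<Rightarrow> 't"
  right :: "'c \<Rightarrow> 't"
  cid :: "'l \<Rightarrow> 'c"
  ccomp :: "'c \<Rightarrow> 't \<Rightarrow> 'c list \<Rightarrow> 'c"

definition tights :: "('o, 't, 'l, 'c) vdc \<Rightarrow> 'o \<Rightarrow> 'o \<Rightarrow> 't set" where
  "tights X A B = {f \<in> Tight X. tdom X f = A \<and> tcod X f = B}"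

definition looses :: "('o, 't, 'l, 'c) vdc \<Rightarrow> 'o \<Rightarrow> 'o \<Rightarrow> 'l set" where
  "looses X A B = {p \<in> Loose X. ldom X p = A \<and> lcod X p = B}"

text \<open>chain X B ps A: ps is a chain of loose-cells from A to B (so A = An and B = A0 above).\<close>

fun chain :: "('o, 't, 'l, 'c) vdc \<Rightarrow> 'o \<Rightarrow> 'l list \<Rightarrow> 'o \<Rightarrow> bool" where
  "chain X B [] A \<longleftrightarrow> A = B \<and> A \<in> Obj X"
| "chain X B (p # ps) A \<longleftrightarrow> p \<in> Loose X \<and> lcod X p = B \<and> chain X (ldom X p) ps A"

definition cells :: "('o, 't, 'l, 'c) vdc \<Rightarrow> 'l list \<Rightarrow> 't \<Rightarrow> 't \<Rightarrow> 'l \<Rightarrow> 'c set" where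
  "cells X ps f g q =
    {\<phi> \<in> Cell X. src X \<phi> = ps \<and> left X \<phi> = f \<and> right X \<phi> = g \<and> tgt X \<phi> = q}"

text \<open>The 2-cells from ps to q whose tight-cells are identities.\<close>

definition gcells :: "('o, 't, 'l, 'c) vdc \<Rightarrow> 'l list \<Rightarrow> 'l \<Rightarrow> 'c set" where
  "gcells X ps q = cells X ps (tid X (lcod X q)) (tid X (ldom X q)) q"

fun cell_path :: "('o, 't, 'l, 'c) vdc \<Rightarrow> 't \<Rightarrow> 'c list \<Rightarrow> 't \<Rightarrow> bool" where
  "cell_path X f [] g \<longleftrightarrow> f = g \<and> f \<in> Tight X"
| "cell_path X f (\<phi> # \<phi>s) g \<longleftrightarrow> \<phi> \<in> Cell X \<and> left X \<phi> = f \<and> cell_path X (right X \<phi>) \<phi>s g"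

definition composable ::
  "('o, 't, 'l, 'c) vdc \<Rightarrow> 'c \<Rightarrow> 't \<Rightarrow> 'c list \<Rightarrow> 't \<Rightarrow> bool" where
  "composable X \<psi> f \<phi>s g \<longleftrightarrow>
    \<psi> \<in> Cell X \<and> cell_path X f \<phi>s g \<and> tcod X f = tdom X (left X \<psi>) \<and> map (tgt X) \<phi>s = src X \<psi>"

locale virtual_double_category =
  fixes X :: "('o, 't, 'l, 'c) vdc"
  assumes tight_obj: "f \<in> Tight X \<Longrightarrow> tdom X f \<in> Obj X \<and> tcod X f \<in> Obj X"
    and tid_tight: "A \<in> Obj X \<Longrightarrow> tid X A \<in> tights X A A"
    and tcomp_tight: "f \<in> tights X A B \<Longrightarrow> g \<in> tights X B C \<Longrightarrow> tcomp X g f \<in> tights X A C"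
    and tcomp_id_left: "f \<in> tights X A B \<Longrightarrow> tcomp X (tid X B) f = f"
    and tcomp_id_right: "f \<in> tights X A B \<Longrightarrow> tcomp X f (tid X A) = f"
    and tcomp_assoc: "f \<in> tights X A B \<Longrightarrow> g \<in> tights X B C \<Longrightarrow> h \<in> tights X C D \<Longrightarrow>
      tcomp X h (tcomp X g f) = tcomp X (tcomp X h g) f"
    and loose_obj: "p \<in> Loose X \<Longrightarrow> ldom X p \<in> Obj X \<and> lcod X p \<in> Obj X"
    and cell_frame: "\<phi> \<in> Cell X \<Longrightarrow> left X \<phi> \<in> Tight X \<and> right X \<phi> \<in> Tight X \<and>
      chain X (tdom X (left X \<phi>)) (src X \<phi>) (tdom X (right X \<phi>)) \<and>
      tgt X \<phi> \<in> looses X (tcod X (right X \<phi>)) (tcod X (left X \<phi>))"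
    and cid_cell: "p \<in> Loose X \<Longrightarrow> cid X p \<in> gcells X [p] p"
    and ccomp_cell: "composable X \<psi> f \<phi>s g \<Longrightarrow>
      ccomp X \<psi> f \<phi>s \<in> cells X (concat (map (src X) \<phi>s))
        (tcomp X (left X \<psi>) f) (tcomp X (right X \<psi>) g) (tgt X \<psi>)"
    and ccomp_id_left: "\<phi> \<in> Cell X \<Longrightarrow> ccomp X (cid X (tgt X \<phi>)) (left X \<phi>) [\<phi>] = \<phi>"
    and ccomp_id_right: "\<phi> \<in> Cell X \<Longrightarrow>
      ccomp X \<phi> (tid X (tdom X (left X \<phi>))) (map (cid X) (src X \<phi>)) = \<phi>"
    and ccomp_assoc: "composable X \<psi> f \<phi>s g \<Longrightarrow>
      length \<chi>ss = length \<phi>s \<Longrightarrow> length hs = Suc (length \<phi>s) \<Longrightarrow>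
      hs ! 0 \<in> Tight X \<Longrightarrow> tcod X (hs ! 0) = tdom X f \<Longrightarrow>
      (\<And>i. i < length \<phi>s \<Longrightarrow> composable X (\<phi>s ! i) (hs ! i) (\<chi>ss ! i) (hs ! Suc i)) \<Longrightarrow>
      ccomp X (ccomp X \<psi> f \<phi>s) (hs ! 0) (concat \<chi>ss) =
      ccomp X \<psi> (tcomp X f (hs ! 0))
        (map (\<lambda>i. ccomp X (\<phi>s ! i) (hs ! i) (\<chi>ss ! i)) [0..<length \<phi>s])"

section \<open>Virtual equipments\<close>

definition opcartesian :: "('o, 't, 'l, 'c) vdc \<Rightarrow> 'c \<Rightarrow> bool" where
  "opcartesian X \<phi> \<longleftrightarrow> \<phi> \<in> gcells X (src X \<phi>) (tgt X \<phi>) \<and>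
    (\<forall>\<psi>\<in>Cell X. \<forall>ps rs. src X \<psi> = ps @ src X \<phi> @ rs \<and>
      chain X (tdom X (left X \<psi>)) (ps @ [tgt X \<phi>] @ rs) (tdom X (right X \<psi>)) \<longrightarrow>
      (\<exists>!\<chi>. \<chi> \<in> cells X (ps @ [tgt X \<phi>] @ rs) (left X \<psi>) (right X \<psi>) (tgt X \<psi>) \<and>
        ccomp X \<chi> (tid X (tdom X (left X \<psi>))) (map (cid X) ps @ [\<phi>] @ map (cid X) rs) = \<psi>))"

definition cartesian :: "('o, 't, 'l, 'c) vdc \<Rightarrow> 'c \<Rightarrow> bool" where
  "cartesian X \<kappa> \<longleftrightarrow> \<kappa> \<in> Cell X \<and> (\<exists>p. src X \<kappa> = [p] \<and>
    (\<forall>f' g'. f' \<in> Tight X \<and> tcod X f' = tdom X (left X \<kappa>) \<and>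
             g' \<in> Tight X \<and> tcod X g' = tdom X (right X \<kappa>) \<longrightarrow>
      (\<forall>ps. \<forall>\<psi> \<in> cells X ps (tcomp X (left X \<kappa>) f') (tcomp X (right X \<kappa>) g') (tgt X \<kappa>).
        \<exists>!\<chi>. \<chi> \<in> cells X ps f' g' p \<and> ccomp X \<kappa> f' [\<chi>] = \<psi>)))"

locale virtual_equipment = virtual_double_category +
  assumes loose_identities: "A \<in> Obj X \<Longrightarrow>
      \<exists>\<eta>. opcartesian X \<eta> \<and> src X \<eta> = [] \<and> tgt X \<eta> \<in> looses X A A"
    and restrictions: "q \<in> Loose X \<Longrightarrow> f \<in> Tight X \<Longrightarrow> g \<in> Tight X \<Longrightarrow>
      tcod X f = lcod X q \<Longrightarrow> tcod X g = ldom X q \<Longrightarrow>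
      \<exists>\<kappa>. cartesian X \<kappa> \<and> tgt X \<kappa> = q \<and> left X \<kappa> = f \<and> right X \<kappa> = g"

text \<open>
  Loose-identities and restrictions are determined up to unique isomorphism; we fix a choice.
\<close>

definition lunit :: "('o, 't, 'l, 'c) vdc \<Rightarrow> 'o \<Rightarrow> 'c" where
  "lunit X A = (SOME \<eta>. opcartesian X \<eta> \<and> src X \<eta> = [] \<and> tgt X \<eta> \<in> looses X A A)"

definition lid :: "('o, 't, 'l, 'c) vdc \<Rightarrow> 'o \<Rightarrow> 'l" where
  "lid X A = tgt X (lunit X A)"

definition rcell :: "('o, 't, 'l, 'c) vdc \<Rightarrow> 'l \<Rightarrow> 't \<Rightarrow> 't \<Rightarrow> 'c" where
  "rcell X q f g = (SOME \<kappa>. cartesian X \<kappa> \<and> tgt X \<kappa> = q \<and> left X \<kappa> = f \<and> right X \<kappa> = g)"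

definition restr :: "('o, 't, 'l, 'c) vdc \<Rightarrow> 'l \<Rightarrow> 't \<Rightarrow> 't \<Rightarrow> 'l" where
  "restr X q f g = hd (src X (rcell X q f g))"

text \<open>
  For f : D -> E and g : A -> E, lhom X f g is the loose-cell E(f,g) : A -|-> D, and hcell X f g
  is the cartesian 2-cell from E(f,g) to E(1,1).
\<close>

definition hcell :: "('o, 't, 'l, 'c) vdc \<Rightarrow> 't \<Rightarrow> 't \<Rightarrow> 'c" where
  "hcell X f g = rcell X (lid X (tcod X f)) f g"

definition lhom :: "('o, 't, 'l, 'c) vdc \<Rightarrow> 't \<Rightarrow> 't \<Rightarrow> 'l" where
  "lhom X f g = restr X (lid X (tcod X f)) f g"

text \<open>The factorisation of \<psi> through a cartesian \<kappa> by a 2-cell with tight-cells f, g.\<close>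

definition factor :: "('o, 't, 'l, 'c) vdc \<Rightarrow> 'c \<Rightarrow> 't \<Rightarrow> 't \<Rightarrow> 'c \<Rightarrow> 'c" where
  "factor X \<kappa> f g \<psi> =
    (THE \<chi>. \<chi> \<in> cells X (src X \<psi>) f g (hd (src X \<kappa>)) \<and> ccomp X \<kappa> f [\<chi>] = \<psi>)"

text \<open>
  The canonical cartesian 2-cell from E(f f', g g') to E(f,g) with tight-cells f', g', exhibiting
  the canonical isomorphism between E(f f', g g') and E(f,g)(f',g').
\<close>

definition hproj :: "('o, 't, 'l, 'c) vdc \<Rightarrow> 't \<Rightarrow> 't \<Rightarrow> 't \<Rightarrow> 't \<Rightarrow> 'c" where
  "hproj X f g f' g' =
    factor X (hcell X f g) f' g' (hcell X (tcomp X f f') (tcomp X g g'))"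

text \<open>
  For p : A -|-> B, the canonical opcartesian 2-cell from p, A(1,1) to p. At p = A(1,1) it is the
  canonical 2-cell from A(1,1), A(1,1) to A(1,1).
\<close>

definition runitor :: "('o, 't, 'l, 'c) vdc \<Rightarrow> 'l \<Rightarrow> 'c" where
  "runitor X p = (THE \<rho>. \<rho> \<in> gcells X [p, lid X (ldom X p)] p \<and>
    ccomp X \<rho> (tid X (lcod X p)) [cid X p, lunit X (ldom X p)] = cid X p)"

text \<open>
  The 2-cell cup X c from B(1,c), B(c,1) to B(1,1), and its restriction cup_at X c x y from
  B(x,c), B(c,y) to B(x,y).
\<close>

definition cup :: "('o, 't, 'l, 'c) vdc \<Rightarrow> 't \<Rightarrow> 'c" where
  "cup X c = (let B = tcod X c in
    ccomp X (runitor X (lid X B)) (tid X B) [hcell X (tid X B) c, hcell X c (tid X B)])"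

definition cup_at :: "('o, 't, 'l, 'c) vdc \<Rightarrow> 't \<Rightarrow> 't \<Rightarrow> 't \<Rightarrow> 'c" where
  "cup_at X c x y = (let A = tdom X c; B = tcod X c in
    factor X (hcell X x y) (tid X (tdom X x)) (tid X (tdom X y))
      (ccomp X (cup X c) x
        [hproj X (tid X B) c x (tid X A), hproj X c (tid X B) (tid X A) y]))"

text \<open>
  For g : A -> B, the 2-cell cap X g from () to B(g,g) corresponds to the identity of g, i.e. to
  the nullary 2-cell into B(1,1) with both tight-cells g. By opcartesianness of the unit it
  extends to cap1 X g from A(1,1) to B(g,g), whose restriction cap_at X g x y from A(x,y) to
  B(g x, g y) is the action of g.
\<close>

definition cap :: "('o, 't, 'l, 'c) vdc \<Rightarrow> 't \<Rightarrow> 'c" where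
  "cap X g = factor X (hcell X g g) (tid X (tdom X g)) (tid X (tdom X g))
    (ccomp X (lunit X (tcod X g)) g [])"

definition cap1 :: "('o, 't, 'l, 'c) vdc \<Rightarrow> 't \<Rightarrow> 'c" where
  "cap1 X g = (THE \<gamma>. \<gamma> \<in> gcells X [lid X (tdom X g)] (lhom X g g) \<and>
    ccomp X \<gamma> (tid X (tdom X g)) [lunit X (tdom X g)] = cap X g)"

definition cap_at :: "('o, 't, 'l, 'c) vdc \<Rightarrow> 't \<Rightarrow> 't \<Rightarrow> 't \<Rightarrow> 'c" where
  "cap_at X g x y = factor X (hproj X g g x y) (tid X (tdom X x)) (tid X (tdom X y))
    (ccomp X (cap1 X g) x [hcell X x y])"

section \<open>Relative adjunctions, density and weighted limits\<close>

definition loose_iso :: "('o, 't, 'l, 'c) vdc \<Rightarrow> 'c \<Rightarrow> 'l \<Rightarrow> 'l \<Rightarrow> bool" where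
  "loose_iso X \<phi> p q \<longleftrightarrow> \<phi> \<in> gcells X [p] q \<and>
    (\<exists>\<psi> \<in> gcells X [q] p.
      ccomp X \<psi> (tid X (lcod X p)) [\<phi>] = cid X p \<and>
      ccomp X \<phi> (tid X (lcod X q)) [\<psi>] = cid X q)"

definition relative_adjunction ::
  "('o, 't, 'l, 'c) vdc \<Rightarrow> 't \<Rightarrow> 't \<Rightarrow> 't \<Rightarrow> 'c \<Rightarrow> bool" where
  "relative_adjunction X j l r \<phi> \<longleftrightarrow>
    (\<exists>A C E. j \<in> tights X A E \<and> l \<in> tights X A C \<and> r \<in> tights X C E \<and>
      loose_iso X \<phi> (lhom X l (tid X C)) (lhom X j r))"

definition right_relative_adjoint :: "('o, 't, 'l, 'c) vdc \<Rightarrow> 't \<Rightarrow> 't \<Rightarrow> bool" where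
  "right_relative_adjoint X j r \<longleftrightarrow> (\<exists>l \<phi>. relative_adjunction X j l r \<phi>)"

definition dense :: "('o, 't, 'l, 'c) vdc \<Rightarrow> 't \<Rightarrow> bool" where
  "dense X j \<longleftrightarrow> (let A = tdom X j; E = tcod X j; p = lhom X j (tid X E) in
    j \<in> Tight X \<and>
    (\<forall>rs. chain X E rs E \<longrightarrow>
      bij_betw (\<lambda>\<phi>. ccomp X (runitor X p) (tid X A) [cid X p, \<phi>])
        (gcells X rs (lid X E)) (gcells X (p # rs) p)))"

definition right_extension ::
  "('o, 't, 'l, 'c) vdc \<Rightarrow> 'l \<Rightarrow> 'l \<Rightarrow> 'l \<Rightarrow> 'c \<Rightarrow> bool" where
  "right_extension X q p s w \<longleftrightarrow>
    p \<in> Loose X \<and> q \<in> looses X (ldom X p) (lcod X q) \<and> s \<in> looses X (lcod X p) (lcod X q) \<and>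
    w \<in> gcells X [s, p] q \<and>
    (\<forall>rs. chain X (lcod X q) rs (lcod X p) \<longrightarrow>
      (\<forall>\<theta> \<in> gcells X (rs @ [p]) q.
        \<exists>!\<psi>. \<psi> \<in> gcells X rs s \<and> ccomp X w (tid X (lcod X q)) [\<psi>, cid X p] = \<theta>))"

definition cone :: "('o, 't, 'l, 'c) vdc \<Rightarrow> 'l \<Rightarrow> 't \<Rightarrow> 't \<Rightarrow> 'c \<Rightarrow> bool" where
  "cone X p f c \<mu> \<longleftrightarrow> p \<in> Loose X \<and> f \<in> tights X (ldom X p) (tcod X f) \<and>
    c \<in> tights X (lcod X p) (tcod X f) \<and> \<mu> \<in> gcells X [p] (lhom X c f)"

definition limiting :: "('o, 't, 'l, 'c) vdc \<Rightarrow> 'l \<Rightarrow> 't \<Rightarrow> 't \<Rightarrow> 'c \<Rightarrow> bool" where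
  "limiting X p f c \<mu> \<longleftrightarrow> cone X p f c \<mu> \<and>
    (let B = tcod X f in
      right_extension X (lhom X (tid X B) f) p (lhom X (tid X B) c)
        (ccomp X (cup_at X c (tid X B) f) (tid X B) [cid X (lhom X (tid X B) c), \<mu>]))"

definition preserves_limit ::
  "('o, 't, 'l, 'c) vdc \<Rightarrow> 't \<Rightarrow> 'l \<Rightarrow> 't \<Rightarrow> 't \<Rightarrow> 'c \<Rightarrow> bool" where
  "preserves_limit X g p f c \<mu> \<longleftrightarrow>
    limiting X p (tcomp X g f) (tcomp X g c)
      (ccomp X (cap_at X g c f) (tid X (lcod X p)) [\<mu>])"

definition preserves_limits :: "('o, 't, 'l, 'c) vdc \<Rightarrow> 't \<Rightarrow> bool" where
  "preserves_limits X g \<longleftrightarrow>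
    (\<forall>p f c \<mu>. tcod X f = tdom X g \<and> limiting X p f c \<mu> \<longrightarrow> preserves_limit X g p f c \<mu>)"

end

theory Submission
  imports Defs
begin

text \<open>
  Composition \<open>E(1,1), E(1,1) \<Rightarrow> E(1,1)\<close> makes 2-cells into \<open>E(1,1)\<close> the arrows of a category: 2-cells
  with tight-cells \<open>x, y\<close> and \<open>y, z\<close> multiply to a 2-cell with tight-cells \<open>x, z\<close>. By cartesianness
  everything can be read off from these 2-cells. A cone \<open>\<mu> : p \<Rightarrow> X(c,f)\<close> is limiting iff right
  multiplication by the corresponding \<open>\<nu>\<close> is a bijection onto the 2-cells from chains ending in \<open>p\<close>,
  with left tight-cell the identity, hence (whiskering with companions) with arbitrary left
  tight-cell; and density of \<open>j\<close> says that left multiplication by \<open>E(j,1) \<Rightarrow> E(1,1)\<close> is bijective.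
  The isomorphism \<open>C(l,1) \<cong> E(j,r)\<close> makes 2-cells into \<open>C(1,1)\<close> with tight-cells \<open>l, y\<close> correspond
  to 2-cells into \<open>E(1,1)\<close> with tight-cells \<open>j, r y\<close>, turning right multiplication by \<open>\<nu>\<close> into right
  multiplication by \<open>r \<nu>\<close>. So for 2-cells with left tight-cell \<open>1\<close>, multiplication by \<open>r \<nu>\<close> is
  conjugate, via \<open>j\<close> and then \<open>l\<close>, to multiplication by \<open>\<nu>\<close>.
\<close>

section \<open>Transfer of bijectivity along commuting squares and retracts\<close>

text \<open>The two composites around the square agree on \<open>A\<close>, and composing a map with
  the bijections \<open>G\<close> or \<open>H\<close> does not change whether it is
  bijective.\<close>

lemma bij_betw_conjugate:
  assumes "bij_betw G A B" and "bij_betw H C D" and "W ` A \<subseteq> C" and "K ` B \<subseteq> D"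
    and "\<And>a. a \<in> A \<Longrightarrow> H (W a) = K (G a)"
  shows "bij_betw W A C \<longleftrightarrow> bij_betw K B D"
proof -
  have "bij_betw W A C \<longleftrightarrow> bij_betw (H \<circ> W) A D"
    using bij_betw_comp_iff2[OF assms(2,3)] .
  also have "\<dots> \<longleftrightarrow> bij_betw (K \<circ> G) A D"
    by (rule bij_betw_cong) (simp add: assms(5))
  also have "\<dots> \<longleftrightarrow> bij_betw K B D"
    by (rule bij_betw_comp_iff[OF assms(1), symmetric])
  finally show ?thesis .
qed

text \<open>The two squares exhibit \<open>W\<close> as a retract of \<open>K\<close>, with sections
  \<open>s\<close>, \<open>t\<close> and retractions \<open>u\<close>, \<open>v\<close>, and a
  retract of a bijection is a bijection: injectivity comes from the square of sections, surjectivity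
  from the square of retractions.\<close>

lemma bij_betw_retract:
  assumes "bij_betw K A' B'" and "s ` A \<subseteq> A'" and "t ` B \<subseteq> B'" and "u ` A' \<subseteq> A"
    and "W ` A \<subseteq> B"
    and "\<And>a. a \<in> A \<Longrightarrow> u (s a) = a" and "\<And>b. b \<in> B \<Longrightarrow> v (t b) = b"
    and "\<And>a. a \<in> A \<Longrightarrow> K (s a) = t (W a)" and "\<And>a. a \<in> A' \<Longrightarrow> W (u a) = v (K a)"
  shows "bij_betw W A B"
proof (rule bij_betw_imageI)
  show "inj_on W A"
  proof (rule inj_onI)
    fix a b assume ab: "a \<in> A" "b \<in> A" "W a = W b"
    then have "K (s a) = K (s b)" using assms(8) by simp
    then have "s a = s b" using assms(1,2) ab by (auto simp: bij_betw_def dest: inj_onD)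
    then show "a = b" using assms(6) ab by metis
  qed
  show "W ` A = B"
  proof (rule antisym)
    show "B \<subseteq> W ` A"
    proof
      fix b assume b: "b \<in> B"
      then obtain a where a: "a \<in> A'" "K a = t b"
        using assms(1,3) by (force simp: bij_betw_def)
      then have "W (u a) = b" using assms(7,9) b by simp
      then show "b \<in> W ` A" using a assms(4) by blast
    qed
  qed (rule assms(5))
qed

text \<open>Cartesian 2-cells and right extensions are defined by unique factorisation; in the form
  of bijections these properties can be composed and conjugated.\<close>

lemma bij_betw_iff_ex1:
  assumes "F ` A \<subseteq> B"
  shows "bij_betw F A B \<longleftrightarrow> (\<forall>b\<in>B. \<exists>!a. a \<in> A \<and> F a = b)"
proof
  assume F: "bij_betw F A B"
  show "\<forall>b\<in>B. \<exists>!a. a \<in> A \<and> F a = b"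
  proof
    fix b assume "b \<in> B"
    then obtain a where "a \<in> A" "F a = b" using F by (auto simp: bij_betw_def)
    then show "\<exists>!a. a \<in> A \<and> F a = b" using F by (auto simp: bij_betw_def dest: inj_onD)
  qed
next
  assume *: "\<forall>b\<in>B. \<exists>!a. a \<in> A \<and> F a = b"
  show "bij_betw F A B"
  proof (rule bij_betw_imageI)
    show "inj_on F A" using * assms by (intro inj_onI) blast
    show "F ` A = B" using * assms by blast
  qed
qed

section \<open>Composition of 2-cells along typed paths\<close>

context virtual_double_category
begin

abbreviation tight_comp (infixr "\<cdot>" 70) where "g \<cdot> f \<equiv> tcomp X g f"

lemma tid_in [simp]:
  "A \<in> Obj X \<Longrightarrow> tid X A \<in> Tight X"
  "A \<in> Obj X \<Longrightarrow> tdom X (tid X A) = A"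
  "A \<in> Obj X \<Longrightarrow> tcod X (tid X A) = A"
  using tid_tight by (auto simp: tights_def)

lemma tight_obj' [simp]:
  "f \<in> Tight X \<Longrightarrow> tdom X f \<in> Obj X"
  "f \<in> Tight X \<Longrightarrow> tcod X f \<in> Obj X"
  using tight_obj by auto

lemma tcomp_in [simp]:
  assumes "f \<in> Tight X" and "g \<in> Tight X" and "tcod X f = tdom X g"
  shows "g \<cdot> f \<in> Tight X" and "tdom X (g \<cdot> f) = tdom X f" and "tcod X (g \<cdot> f) = tcod X g"
  using tcomp_tight[of f "tdom X f" "tcod X f" g "tcod X g"] assms by (auto simp: tights_def)

lemma tcomp_tid [simp]:
  "f \<in> Tight X \<Longrightarrow> tcod X f = B \<Longrightarrow> tid X B \<cdot> f = f"
  "f \<in> Tight X \<Longrightarrow> tdom X f = A \<Longrightarrow> f \<cdot> tid X A = f"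
  using tcomp_id_left[of f A] tcomp_id_left[of f "tdom X f" B] tcomp_id_right[of f A "tcod X f"]
  by (auto simp: tights_def)

lemma tcomp_assoc':
  "f \<in> Tight X \<Longrightarrow> g \<in> Tight X \<Longrightarrow> h \<in> Tight X \<Longrightarrow> tcod X f = tdom X g \<Longrightarrow>
    tcod X g = tdom X h \<Longrightarrow> (h \<cdot> g) \<cdot> f = h \<cdot> g \<cdot> f"
  using tcomp_assoc[of f "tdom X f" "tcod X f" g "tcod X g" h "tcod X h"]
  by (auto simp: tights_def)

lemma loose_obj' [simp]:
  "p \<in> Loose X \<Longrightarrow> ldom X p \<in> Obj X"
  "p \<in> Loose X \<Longrightarrow> lcod X p \<in> Obj X"
  using loose_obj by auto

lemma cellsD:
  assumes "\<phi> \<in> cells X ps f g q"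
  shows "\<phi> \<in> Cell X" and "src X \<phi> = ps" and "left X \<phi> = f" and "right X \<phi> = g" and "tgt X \<phi> = q"
  using assms by (auto simp: cells_def)

lemma cells_frame:
  assumes "\<phi> \<in> cells X ps f g q"
  shows "f \<in> Tight X" and "g \<in> Tight X" and "q \<in> Loose X" and "chain X (tdom X f) ps (tdom X g)"
    and "tcod X f = lcod X q" and "tcod X g = ldom X q"
  using assms cell_frame[of \<phi>] by (auto simp: cells_def looses_def)

text \<open>Carrying both chains and both outer tight-cells as indices lets the frame of a composite
  be assembled by introduction rules, without unfolding \<open>composable\<close> each time.\<close>

definition cpaths :: "'l list \<Rightarrow> 't \<Rightarrow> 't \<Rightarrow> 'l list \<Rightarrow> 'c list set" where
  "cpaths ps f g qs =
    {\<phi>s. cell_path X f \<phi>s g \<and> concat (map (src X) \<phi>s) = ps \<and> map (tgt X) \<phi>s = qs}"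

lemma chain_obj: "chain X B ps A \<Longrightarrow> A \<in> Obj X \<and> B \<in> Obj X"
  by (induction ps arbitrary: B) auto

lemma chain_append:
  "chain X B (ps @ qs) A \<longleftrightarrow> (\<exists>C. chain X B ps C \<and> chain X C qs A)"
  by (induction ps arbitrary: B) (auto dest: chain_obj)

lemma cpaths_Nil: "f \<in> Tight X \<Longrightarrow> [] \<in> cpaths [] f f []"
  by (simp add: cpaths_def)

lemma cpaths_Cons:
  "\<phi> \<in> cells X ps f g q \<Longrightarrow> \<phi>s \<in> cpaths ps' g h qs \<Longrightarrow> \<phi> # \<phi>s \<in> cpaths (ps @ ps') f h (q # qs)"
  by (auto simp: cpaths_def cells_def)

lemma cpaths_single: "\<phi> \<in> cells X ps f g q \<Longrightarrow> [\<phi>] \<in> cpaths ps f g [q]"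
  using cpaths_Cons[of \<phi> ps f g q "[]" "[]" g "[]"] cpaths_Nil cells_frame(2) by simp

lemma cpaths_append:
  "\<phi>s \<in> cpaths ps f g qs \<Longrightarrow> \<psi>s \<in> cpaths ps' g h qs' \<Longrightarrow>
    \<phi>s @ \<psi>s \<in> cpaths (ps @ ps') f h (qs @ qs')"
proof (induction \<phi>s arbitrary: f ps qs)
  case Nil
  then show ?case by (simp add: cpaths_def)
next
  case (Cons \<phi> \<phi>s)
  from Cons.prems(1) have \<phi>: "\<phi> \<in> cells X (src X \<phi>) f (right X \<phi>) (tgt X \<phi>)"
    and \<phi>s: "\<phi>s \<in> cpaths (concat (map (src X) \<phi>s)) (right X \<phi>) g (map (tgt X) \<phi>s)"
    and "ps = src X \<phi> @ concat (map (src X) \<phi>s)" and "qs = tgt X \<phi> # map (tgt X) \<phi>s"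
    by (auto simp: cpaths_def cells_def)
  then show ?case using cpaths_Cons[OF \<phi> Cons.IH[OF \<phi>s Cons.prems(2)]] by simp
qed

lemma cid_in: "p \<in> Loose X \<Longrightarrow> cid X p \<in> cells X [p] (tid X (lcod X p)) (tid X (ldom X p)) p"
  using cid_cell by (simp add: gcells_def)

lemma cpaths_cid: "chain X B ps A \<Longrightarrow> map (cid X) ps \<in> cpaths ps (tid X B) (tid X A) ps"
proof (induction ps arbitrary: B)
  case Nil
  then have "A = B" and "tid X B \<in> Tight X" by auto
  then show ?case using cpaths_Nil by simp
next
  case (Cons p ps)
  then have "cid X p \<in> cells X [p] (tid X B) (tid X (ldom X p)) p"
    using cid_in by auto
  then show ?case using cpaths_Cons Cons by fastforce
qed

text \<open>Consecutive 2-cells share a tight-cell, so codomains are passed on along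
  \<open>qs\<close>. This yields the matching condition at the place where two paths are
  joined.\<close>

lemma cpaths_cod: "\<phi>s \<in> cpaths ps f g qs \<Longrightarrow> chain X (tcod X f) qs A \<Longrightarrow> tcod X g = A"
proof (induction \<phi>s arbitrary: f ps qs)
  case Nil
  then show ?case by (auto simp: cpaths_def)
next
  case (Cons \<phi> \<phi>s)
  from Cons.prems(1) have \<phi>: "\<phi> \<in> cells X (src X \<phi>) f (right X \<phi>) (tgt X \<phi>)"
    and \<phi>s: "\<phi>s \<in> cpaths (concat (map (src X) \<phi>s)) (right X \<phi>) g (map (tgt X) \<phi>s)"
    and "qs = tgt X \<phi> # map (tgt X) \<phi>s"
    by (auto simp: cpaths_def cells_def)
  then show ?case using Cons.IH[OF \<phi>s] Cons.prems(2) cells_frame(6)[OF \<phi>] by simp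
qed

section \<open>Frames, associativity and identities of composites\<close>

lemma composableI:
  "\<psi> \<in> cells X qs f g t \<Longrightarrow> \<phi>s \<in> cpaths ps x y qs \<Longrightarrow> tcod X x = tdom X f \<Longrightarrow>
    composable X \<psi> x \<phi>s y"
  by (auto simp: composable_def cells_def cpaths_def)

lemma ccomp_in:
  "\<psi> \<in> cells X qs f g t \<Longrightarrow> \<phi>s \<in> cpaths ps x y qs \<Longrightarrow> tcod X x = tdom X f \<Longrightarrow>
    ccomp X \<psi> x \<phi>s \<in> cells X ps (f \<cdot> x) (g \<cdot> y) t"
  using ccomp_cell[OF composableI] by (auto simp: cells_def cpaths_def)

lemma cells_match:
  "\<psi> \<in> cells X (q # qs) f g t \<Longrightarrow> \<phi> \<in> cells X ps x y q \<Longrightarrow> tcod X x = tdom X f"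
  using cells_frame(4)[of \<psi> "q # qs"] cells_frame(5)[of \<phi>] by auto

lemma ccomp1_in:
  "\<psi> \<in> cells X [q] f g t \<Longrightarrow> \<phi> \<in> cells X ps x y q \<Longrightarrow>
    ccomp X \<psi> x [\<phi>] \<in> cells X ps (f \<cdot> x) (g \<cdot> y) t"
  by (rule ccomp_in[OF _ cpaths_single cells_match])

lemma cpaths_pair:
  "\<phi> \<in> cells X ps x y q \<Longrightarrow> \<phi>' \<in> cells X ps' y z q' \<Longrightarrow> [\<phi>, \<phi>'] \<in> cpaths (ps @ ps') x z [q, q']"
  by (intro cpaths_Cons cpaths_single)

lemma ccomp2_in:
  "\<psi> \<in> cells X [q, q'] f g t \<Longrightarrow> \<phi> \<in> cells X ps x y q \<Longrightarrow> \<phi>' \<in> cells X ps' y z q' \<Longrightarrow>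
    ccomp X \<psi> x [\<phi>, \<phi>'] \<in> cells X (ps @ ps') (f \<cdot> x) (g \<cdot> z) t"
  by (rule ccomp_in[OF _ cpaths_pair cells_match])

lemma ccomp_assoc1:
  assumes \<psi>: "\<psi> \<in> cells X [q] f g t" and \<phi>: "\<phi> \<in> cells X qs x y q"
    and \<chi>s: "\<chi>s \<in> cpaths ps h k qs" and "tcod X h = tdom X x" "h \<in> Tight X"
  shows "ccomp X (ccomp X \<psi> x [\<phi>]) h \<chi>s = ccomp X \<psi> (x \<cdot> h) [ccomp X \<phi> h \<chi>s]"
proof -
  have "composable X \<psi> x [\<phi>] y"
    by (rule composableI[OF \<psi> cpaths_single[OF \<phi>] cells_match[OF \<psi> \<phi>]])
  \<comment> \<open>The list \<open>hs\<close> of \<open>ccomp_assoc\<close> holds the tight-cells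
    at which successive inner paths begin and end; a single inner path has just the ends
    \<open>h\<close> and \<open>k\<close>.\<close>
  then show ?thesis
    using ccomp_assoc[of \<psi> x "[\<phi>]" y "[\<chi>s]" "[h, k]"] composableI[OF \<phi> \<chi>s] assms(4,5) by simp
qed

lemma cpaths_tight: "\<phi>s \<in> cpaths ps f g qs \<Longrightarrow> f \<in> Tight X \<and> g \<in> Tight X"
proof (induction \<phi>s arbitrary: f ps qs)
  case Nil
  then show ?case by (auto simp: cpaths_def)
next
  case (Cons \<phi> \<phi>s)
  then have "\<phi> \<in> Cell X" and "left X \<phi> = f" 
    and \<phi>s: "\<phi>s \<in> cpaths (concat (map (src X) \<phi>s)) (right X \<phi>) g (map (tgt X) \<phi>s)"
    by (auto simp: cpaths_def)
  then show ?case using Cons.IH[OF \<phi>s] cell_frame by auto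
qed

lemma ccomp_assoc2:
  assumes \<psi>: "\<psi> \<in> cells X [q, q'] f g t" and \<phi>: "\<phi> \<in> cells X qs x y q"
    and \<phi>': "\<phi>' \<in> cells X qs' y z q'"
    and \<chi>s: "\<chi>s \<in> cpaths ps h k qs" and \<chi>s': "\<chi>s' \<in> cpaths ps' k l qs'" and h: "tcod X h = tdom X x"
  shows "ccomp X (ccomp X \<psi> x [\<phi>, \<phi>']) h (\<chi>s @ \<chi>s') =
    ccomp X \<psi> (x \<cdot> h) [ccomp X \<phi> h \<chi>s, ccomp X \<phi>' k \<chi>s']"
proof -
  \<comment> \<open>The inner paths meet at \<open>k\<close>, where the composite with
    \<open>\<phi>'\<close> is formed.\<close>
  have k: "tcod X k = tdom X y" using cpaths_cod[OF \<chi>s] cells_frame(4)[OF \<phi>] h by simp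
  have "composable X \<psi> x [\<phi>, \<phi>'] z"
    by (rule composableI[OF \<psi> cpaths_pair[OF \<phi> \<phi>'] cells_match[OF \<psi> \<phi>]])
  moreover have "composable X ([\<phi>, \<phi>'] ! i) ([h, k, l] ! i) ([\<chi>s, \<chi>s'] ! i) ([h, k, l] ! Suc i)"
    if "i < length [\<phi>, \<phi>']" for i
    using that composableI[OF \<phi> \<chi>s h] composableI[OF \<phi>' \<chi>s' k] by (auto simp: less_Suc_eq)
  ultimately show ?thesis
    using ccomp_assoc[of \<psi> x "[\<phi>, \<phi>']" z "[\<chi>s, \<chi>s']" "[h, k, l]"] h cpaths_tight[OF \<chi>s] by simp
qed

lemma ccomp_cid_left: "\<phi> \<in> cells X ps f g q \<Longrightarrow> ccomp X (cid X q) f [\<phi>] = \<phi>"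
  using ccomp_id_left[of \<phi>] by (auto simp: cells_def)

lemma ccomp_cid_right:
  "\<phi> \<in> cells X ps f g q \<Longrightarrow> A = tdom X f \<Longrightarrow> ccomp X \<phi> (tid X A) (map (cid X) ps) = \<phi>"
  using ccomp_id_right[of \<phi>] by (auto simp: cells_def)

end

section \<open>Multiplication of 2-cells into a loose-identity\<close>

context virtual_equipment
begin

lemma lunit_spec:
  assumes "A \<in> Obj X"
  shows "opcartesian X (lunit X A) \<and> src X (lunit X A) = [] \<and> tgt X (lunit X A) \<in> looses X A A"
  using someI_ex[OF loose_identities[OF assms]] by (simp add: lunit_def)

lemma lid_in [simp]:
  assumes "A \<in> Obj X"
  shows "lid X A \<in> Loose X" and "ldom X (lid X A) = A" and "lcod X (lid X A) = A"
  using lunit_spec[OF assms] by (auto simp: lid_def looses_def)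

lemma lunit_in:
  assumes "A \<in> Obj X"
  shows "lunit X A \<in> cells X [] (tid X A) (tid X A) (lid X A)"
  using lunit_spec[OF assms] lid_in[OF assms] by (auto simp: opcartesian_def gcells_def lid_def)

lemma unit_ext1:
  assumes "A \<in> Obj X" and \<psi>: "\<psi> \<in> cells X ps f g q" and "tdom X g = A"
    and chain: "chain X (tdom X f) (ps @ [lid X A]) (tdom X g)"
  shows "\<exists>!\<chi>. \<chi> \<in> cells X (ps @ [lid X A]) f g q \<and>
    ccomp X \<chi> (tid X (tdom X f)) (map (cid X) ps @ [lunit X A]) = \<psi>"
proof -
  have op: "opcartesian X (lunit X A)" and src: "src X (lunit X A) = []"
    using lunit_spec[OF assms(1)] by auto
  have univ: "\<forall>ps rs. src X \<psi> = ps @ src X (lunit X A) @ rs \<and>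
      chain X (tdom X (left X \<psi>)) (ps @ [lid X A] @ rs) (tdom X (right X \<psi>)) \<longrightarrow>
      (\<exists>!\<chi>. \<chi> \<in> cells X (ps @ [lid X A] @ rs) (left X \<psi>) (right X \<psi>) (tgt X \<psi>) \<and>
        ccomp X \<chi> (tid X (tdom X (left X \<psi>))) (map (cid X) ps @ [lunit X A] @ map (cid X) rs) = \<psi>)"
    using op cellsD(1)[OF \<psi>] unfolding opcartesian_def lid_def by blast
  show ?thesis using univ[rule_format, of ps "[]"] cellsD[OF \<psi>] src chain by simp
qed

text \<open>Extension along the opcartesian unit is unique, so 2-cells may be compared after
  inserting the unit into a last slot \<open>lid X A\<close>. The laws of \<open>hmul\<close> are
  obtained in this way.\<close>

lemma unit_cancel:
  assumes A: "A \<in> Obj X" and \<chi>: "\<chi> \<in> cells X (ps @ [lid X A]) f g q"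
    and \<chi>': "\<chi>' \<in> cells X (ps @ [lid X A]) f g q"
    and eq: "ccomp X \<chi> (tid X (tdom X f)) (map (cid X) ps @ [lunit X A]) =
      ccomp X \<chi>' (tid X (tdom X f)) (map (cid X) ps @ [lunit X A])"
  shows "\<chi> = \<chi>'"
proof -
  have chain: "chain X (tdom X f) (ps @ [lid X A]) (tdom X g)" by (rule cells_frame(4)[OF \<chi>])
  then have g: "tdom X g = A" and ps: "chain X (tdom X f) ps A" using A by (auto simp: chain_append)
  have "map (cid X) ps @ [lunit X A] \<in> cpaths (ps @ []) (tid X (tdom X f)) (tid X A) (ps @ [lid X A])"
    by (rule cpaths_append[OF cpaths_cid[OF ps] cpaths_single[OF lunit_in[OF A]]])
  then have "ccomp X \<chi> (tid X (tdom X f)) (map (cid X) ps @ [lunit X A]) \<in> cells X ps f g q"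
    using ccomp_in[OF \<chi>] cells_frame[OF \<chi>] g by fastforce
  from unit_ext1[OF A this g chain] show ?thesis using \<chi> \<chi>' eq by metis
qed

lemma runitor_spec:
  assumes "p \<in> Loose X" and "ldom X p = A" and "lcod X p = B"
  shows "runitor X p \<in> cells X [p, lid X A] (tid X B) (tid X A) p"
    and "ccomp X (runitor X p) (tid X B) [cid X p, lunit X A] = cid X p"
proof -
  have AB: "A \<in> Obj X" "B \<in> Obj X" using assms by auto
  have "cid X p \<in> cells X [p] (tid X B) (tid X A) p" using cid_in[OF assms(1)] assms by simp
  from unit_ext1[OF AB(1) this] have
    "\<exists>!\<rho>. \<rho> \<in> gcells X [p, lid X (ldom X p)] p \<and>
      ccomp X \<rho> (tid X (lcod X p)) [cid X p, lunit X (ldom X p)] = cid X p"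
    using assms AB by (simp add: gcells_def)
  from theI'[OF this] show "runitor X p \<in> cells X [p, lid X A] (tid X B) (tid X A) p"
    and "ccomp X (runitor X p) (tid X B) [cid X p, lunit X A] = cid X p"
    using assms by (auto simp: runitor_def gcells_def)
qed

text \<open>The unit composed with the degenerate path at \<open>x\<close>: the nullary 2-cell that
  corresponds to the identity of \<open>x\<close>, and the identity arrow at \<open>x\<close> for
  \<open>hmul\<close>.\<close>

abbreviation unit_cell where "unit_cell A x \<equiv> ccomp X (lunit X A) x []"

lemma unit_cell_in:
  assumes "x \<in> Tight X" and "tcod X x = A"
  shows "unit_cell A x \<in> cells X [] x x (lid X A)"
  using ccomp_in[OF lunit_in cpaths_Nil, of A x] assms tight_obj'[of x] by auto

text \<open>Precompose the defining equation of \<open>runitor X p\<close> with the path consisting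
  of \<open>\<alpha>\<close> alone: \<open>\<alpha>\<close> meets the identity of \<open>p\<close>,
  and the unit meets an empty path.\<close>

lemma runitor_unit:
  assumes \<alpha>: "\<alpha> \<in> cells X ps x y p" and p: "ldom X p = A"
  shows "ccomp X (runitor X p) x [\<alpha>, unit_cell A y] = \<alpha>"
proof -
  have P: "p \<in> Loose X" and y: "y \<in> Tight X" "tcod X y = A" and x: "x \<in> Tight X" "tcod X x = lcod X p"
    using cells_frame[OF \<alpha>] p by auto
  note \<rho> = runitor_spec[OF P p refl]
  have A: "A \<in> Obj X" using P p by auto
  have c: "cid X p \<in> cells X [p] (tid X (lcod X p)) (tid X A) p" using cid_in[OF P] p by simp
  have "ccomp X (ccomp X (runitor X p) (tid X (lcod X p)) [cid X p, lunit X A]) x ([\<alpha>] @ []) =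
    ccomp X (runitor X p) (tid X (lcod X p) \<cdot> x) [ccomp X (cid X p) x [\<alpha>], unit_cell A y]"
    using P x y by (intro ccomp_assoc2[OF \<rho>(1) c lunit_in[OF A] cpaths_single[OF \<alpha>] cpaths_Nil]) auto
  then show ?thesis using \<rho>(2) ccomp_cid_left[OF \<alpha>] x by simp
qed

text \<open>At \<open>lid X A\<close> the right unitor is the multiplication of
  \<open>A(1,1)\<close>. Factors stand in diagrammatic order, and the tight-cell argument of
  \<open>ccomp\<close> is read off from the left factor.\<close>

definition hmul where
  "hmul A \<alpha> \<beta> = ccomp X (runitor X (lid X A)) (left X \<alpha>) [\<alpha>, \<beta>]"

lemma mult_in:
  assumes "A \<in> Obj X"
  shows "runitor X (lid X A) \<in> cells X [lid X A, lid X A] (tid X A) (tid X A) (lid X A)"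
  using runitor_spec(1)[of "lid X A" A A] assms by simp

lemma hmul_eq: "\<alpha> \<in> cells X ps x y q \<Longrightarrow> hmul A \<alpha> \<beta> = ccomp X (runitor X (lid X A)) x [\<alpha>, \<beta>]"
  by (auto simp: hmul_def cells_def)

lemma hmul_in:
  assumes "A \<in> Obj X" and "\<alpha> \<in> cells X ps x y (lid X A)" and "\<beta> \<in> cells X qs y z (lid X A)"
  shows "hmul A \<alpha> \<beta> \<in> cells X (ps @ qs) x z (lid X A)"
  using ccomp2_in[OF mult_in[OF assms(1)] assms(2,3)] cells_frame[OF assms(2)]
    cells_frame[OF assms(3)] assms(1) by (simp add: hmul_eq[OF assms(2)])

lemma hmul_unit_right:
  assumes "A \<in> Obj X" and "\<alpha> \<in> cells X ps x y (lid X A)"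
  shows "hmul A \<alpha> (unit_cell A y) = \<alpha>"
  using runitor_unit[OF assms(2), of A] assms(1) by (simp add: hmul_eq[OF assms(2)])

text \<open>Associativity with the multiplication as outer 2-cell: precomposition with a path that
  splits in two acts on each factor separately.\<close>

lemma hmul_ccomp:
  assumes A: "A \<in> Obj X" and \<alpha>: "\<alpha> \<in> cells X ps x y (lid X A)" and \<beta>: "\<beta> \<in> cells X qs y z (lid X A)"
    and "\<chi>s \<in> cpaths ps' h k ps" and "\<chi>s' \<in> cpaths qs' k l qs" and "tcod X h = tdom X x"
  shows "ccomp X (hmul A \<alpha> \<beta>) h (\<chi>s @ \<chi>s') = hmul A (ccomp X \<alpha> h \<chi>s) (ccomp X \<beta> k \<chi>s')"
  using ccomp_assoc2[OF mult_in[OF A] assms(2-)]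
    hmul_eq[OF ccomp_in[OF \<alpha> assms(4,6)], of A] by (simp add: hmul_eq[OF \<alpha>])

lemma lid_cid_in: "A \<in> Obj X \<Longrightarrow> cid X (lid X A) \<in> cells X [lid X A] (tid X A) (tid X A) (lid X A)"
  using cid_in[of "lid X A"] by simp

lemma unit_cell_tid: "A \<in> Obj X \<Longrightarrow> unit_cell A (tid X A) = lunit X A"
  using ccomp_cid_right[OF lunit_in, of A A] by simp

text \<open>The unitor is normalised on the right only, so the left law needs an argument: with the
  unit inserted, the left side becomes the unit times itself, which the right law evaluates.\<close>

lemma hmul_lunit_cid:
  assumes A: "A \<in> Obj X"
  shows "hmul A (lunit X A) (cid X (lid X A)) = cid X (lid X A)"
proof (rule unit_cancel[OF A, of _ "[]"])
  note u = lunit_in[OF A] and c = lid_cid_in[OF A]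
  show "hmul A (lunit X A) (cid X (lid X A)) \<in> cells X ([] @ [lid X A]) (tid X A) (tid X A) (lid X A)"
    by (rule hmul_in[OF A u c])
  show "cid X (lid X A) \<in> cells X ([] @ [lid X A]) (tid X A) (tid X A) (lid X A)" using c by simp
  have "ccomp X (hmul A (lunit X A) (cid X (lid X A))) (tid X A) ([] @ [lunit X A]) =
    hmul A (unit_cell A (tid X A)) (ccomp X (cid X (lid X A)) (tid X A) [lunit X A])"
    using A by (intro hmul_ccomp[OF A u c cpaths_Nil cpaths_single[OF u]]) auto
  also have "\<dots> = lunit X A"
    using hmul_unit_right[OF A u] by (simp add: unit_cell_tid A ccomp_cid_left[OF u])
  also have "\<dots> = ccomp X (cid X (lid X A)) (tid X A) [lunit X A]" by (simp add: ccomp_cid_left[OF u])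
  finally show "ccomp X (hmul A (lunit X A) (cid X (lid X A))) (tid X (tdom X (tid X A)))
      (map (cid X) [] @ [lunit X A]) =
    ccomp X (cid X (lid X A)) (tid X (tdom X (tid X A))) (map (cid X) [] @ [lunit X A])"
    using A by simp
qed

text \<open>The identity of \<open>lid X A\<close> is generic: precomposing its law with
  \<open>\<beta>\<close> gives the law for \<open>\<beta>\<close>.\<close>

lemma hmul_unit_left:
  assumes A: "A \<in> Obj X" and \<beta>: "\<beta> \<in> cells X ps x y (lid X A)"
  shows "hmul A (unit_cell A x) \<beta> = \<beta>"
proof -
  have x: "x \<in> Tight X" "tcod X x = A" using cells_frame[OF \<beta>] A by auto
  have "ccomp X (hmul A (lunit X A) (cid X (lid X A))) x ([] @ [\<beta>]) =
    hmul A (unit_cell A x) (ccomp X (cid X (lid X A)) x [\<beta>])"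
    using A x by (intro hmul_ccomp[OF A lunit_in[OF A] lid_cid_in[OF A] cpaths_Nil cpaths_single[OF \<beta>]]) auto
  then show ?thesis by (simp add: hmul_lunit_cid[OF A] ccomp_cid_left[OF \<beta>])
qed

text \<open>Inserting the unit into the third slot reduces both ternary 2-cells to the
  multiplication itself.\<close>

lemma mult_assoc:
  assumes A: "A \<in> Obj X"
  shows "hmul A (runitor X (lid X A)) (cid X (lid X A)) = hmul A (cid X (lid X A)) (runitor X (lid X A))"
proof (rule unit_cancel[OF A, of _ "[lid X A, lid X A]"])
  let ?m = "runitor X (lid X A)" and ?i = "cid X (lid X A)"
  note u = lunit_in[OF A] and c = lid_cid_in[OF A] and m = mult_in[OF A]
  show "hmul A ?m ?i \<in> cells X ([lid X A, lid X A] @ [lid X A]) (tid X A) (tid X A) (lid X A)"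
    by (rule hmul_in[OF A m c])
  show "hmul A ?i ?m \<in> cells X ([lid X A, lid X A] @ [lid X A]) (tid X A) (tid X A) (lid X A)"
    using hmul_in[OF A c m] by simp
  have "ccomp X (hmul A ?m ?i) (tid X A) ([?i, ?i] @ [lunit X A]) =
    hmul A (ccomp X ?m (tid X A) [?i, ?i]) (ccomp X ?i (tid X A) [lunit X A])"
    using A by (intro hmul_ccomp[OF A m c cpaths_pair[OF c c] cpaths_single[OF u]]) auto
  also have "\<dots> = hmul A ?m (lunit X A)"
    using ccomp_cid_right[OF m, of A] A by (simp add: ccomp_cid_left[OF u])
  also have "\<dots> = ?m" using hmul_unit_right[OF A m] by (simp add: unit_cell_tid A)
  finally have 1: "ccomp X (hmul A ?m ?i) (tid X A) ([?i, ?i] @ [lunit X A]) = ?m" .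
  have "ccomp X (hmul A ?i ?m) (tid X A) ([?i] @ [?i, lunit X A]) =
    hmul A (ccomp X ?i (tid X A) [?i]) (ccomp X ?m (tid X A) [?i, lunit X A])"
    using A by (intro hmul_ccomp[OF A c m cpaths_single[OF c] cpaths_pair[OF c u]]) auto
  also have "\<dots> = hmul A ?i ?i"
    using runitor_spec(2)[of "lid X A" A A] A by (simp add: ccomp_cid_left[OF c])
  also have "\<dots> = ?m" using ccomp_cid_right[OF m, of A] A by (simp add: hmul_eq[OF c])
  finally show "ccomp X (hmul A ?m ?i) (tid X (tdom X (tid X A)))
      (map (cid X) [lid X A, lid X A] @ [lunit X A]) =
    ccomp X (hmul A ?i ?m) (tid X (tdom X (tid X A)))
      (map (cid X) [lid X A, lid X A] @ [lunit X A])"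
    using A 1 by simp
qed

text \<open>Precompose the generic law \<open>mult_assoc\<close> with the path of the three
  factors.\<close>

lemma hmul_assoc:
  assumes A: "A \<in> Obj X" and \<alpha>: "\<alpha> \<in> cells X ps x y (lid X A)"
    and \<beta>: "\<beta> \<in> cells X qs y z (lid X A)" and \<gamma>: "\<gamma> \<in> cells X rs z w (lid X A)"
  shows "hmul A (hmul A \<alpha> \<beta>) \<gamma> = hmul A \<alpha> (hmul A \<beta> \<gamma>)"
proof -
  let ?m = "runitor X (lid X A)" and ?i = "cid X (lid X A)"
  note c = lid_cid_in[OF A] and m = mult_in[OF A]
  have x: "tcod X x = A" using cells_frame[OF \<alpha>] A by auto
  have "ccomp X (hmul A ?m ?i) x ([\<alpha>, \<beta>] @ [\<gamma>]) =
    hmul A (ccomp X ?m x [\<alpha>, \<beta>]) (ccomp X ?i z [\<gamma>])"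
    using A x by (intro hmul_ccomp[OF A m c cpaths_pair[OF \<alpha> \<beta>] cpaths_single[OF \<gamma>]]) auto
  moreover have "ccomp X (hmul A ?i ?m) x ([\<alpha>] @ [\<beta>, \<gamma>]) =
    hmul A (ccomp X ?i x [\<alpha>]) (ccomp X ?m y [\<beta>, \<gamma>])"
    using A x by (intro hmul_ccomp[OF A c m cpaths_single[OF \<alpha>] cpaths_pair[OF \<beta> \<gamma>]]) auto
  ultimately show ?thesis
    by (simp add: mult_assoc[OF A] ccomp_cid_left[OF \<alpha>] ccomp_cid_left[OF \<gamma>]
        hmul_eq[OF \<alpha>] hmul_eq[OF \<beta>])
qed

section \<open>Cartesian 2-cells\<close>

lemma cart_bij:
  assumes "cartesian X \<kappa>" and "\<kappa> \<in> cells X [p] f g q"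
    and "f' \<in> Tight X" and "tcod X f' = tdom X f" and "g' \<in> Tight X" and "tcod X g' = tdom X g"
  shows "bij_betw (\<lambda>\<chi>. ccomp X \<kappa> f' [\<chi>]) (cells X ps f' g' p) (cells X ps (f \<cdot> f') (g \<cdot> g') q)"
proof (subst bij_betw_iff_ex1)
  show "(\<lambda>\<chi>. ccomp X \<kappa> f' [\<chi>]) ` cells X ps f' g' p \<subseteq> cells X ps (f \<cdot> f') (g \<cdot> g') q"
    using ccomp1_in[OF assms(2)] by blast
  show "\<forall>\<psi>\<in>cells X ps (f \<cdot> f') (g \<cdot> g') q. \<exists>!\<chi>. \<chi> \<in> cells X ps f' g' p \<and> ccomp X \<kappa> f' [\<chi>] = \<psi>"
    using assms cellsD[OF assms(2)] by (auto simp: cartesian_def)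
qed

lemma cartesianI:
  assumes \<kappa>: "\<kappa> \<in> cells X [p] f g q"
    and bij: "\<And>ps f' g'. f' \<in> Tight X \<Longrightarrow> tcod X f' = tdom X f \<Longrightarrow> g' \<in> Tight X \<Longrightarrow>
      tcod X g' = tdom X g \<Longrightarrow>
      bij_betw (\<lambda>\<chi>. ccomp X \<kappa> f' [\<chi>]) (cells X ps f' g' p) (cells X ps (f \<cdot> f') (g \<cdot> g') q)"
  shows "cartesian X \<kappa>"
  unfolding cartesian_def
proof (intro conjI exI[of _ p] allI impI)
  show "\<kappa> \<in> Cell X" and "src X \<kappa> = [p]" using cellsD[OF \<kappa>] by auto
  fix f' g' ps
  assume *: "f' \<in> Tight X \<and> tcod X f' = tdom X (left X \<kappa>) \<and>
    g' \<in> Tight X \<and> tcod X g' = tdom X (right X \<kappa>)"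
  have "(\<lambda>\<chi>. ccomp X \<kappa> f' [\<chi>]) ` cells X ps f' g' p \<subseteq> cells X ps (f \<cdot> f') (g \<cdot> g') q"
    using ccomp1_in[OF \<kappa>] by blast
  from bij_betw_iff_ex1[OF this] bij[of f' g' ps]
  show "\<forall>\<psi>\<in>cells X ps (left X \<kappa> \<cdot> f') (right X \<kappa> \<cdot> g') (tgt X \<kappa>).
      \<exists>!\<chi>. \<chi> \<in> cells X ps f' g' p \<and> ccomp X \<kappa> f' [\<chi>] = \<psi>"
    using * cellsD[OF \<kappa>] by simp
qed

lemma factor_spec:
  assumes "cartesian X \<kappa>" and \<kappa>: "\<kappa> \<in> cells X [p] f g q"
    and "f' \<in> Tight X" and "tcod X f' = tdom X f" and "g' \<in> Tight X" and "tcod X g' = tdom X g"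
    and \<psi>: "\<psi> \<in> cells X ps (f \<cdot> f') (g \<cdot> g') q"
  shows "factor X \<kappa> f' g' \<psi> \<in> cells X ps f' g' p"
    and "ccomp X \<kappa> f' [factor X \<kappa> f' g' \<psi>] = \<psi>"
proof -
  have "\<exists>!\<chi>. \<chi> \<in> cells X (src X \<psi>) f' g' (hd (src X \<kappa>)) \<and> ccomp X \<kappa> f' [\<chi>] = \<psi>"
    using assms cellsD[OF \<kappa>] cellsD[OF \<psi>] by (auto simp: cartesian_def)
  from theI'[OF this] show "factor X \<kappa> f' g' \<psi> \<in> cells X ps f' g' p"
    and "ccomp X \<kappa> f' [factor X \<kappa> f' g' \<psi>] = \<psi>"
    using cellsD[OF \<kappa>] cellsD[OF \<psi>] by (auto simp: factor_def)
qed

lemma hcell_spec: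
  assumes "f \<in> Tight X" and "g \<in> Tight X" and "tcod X f = A" and "tcod X g = A"
  shows "cartesian X (hcell X f g)" and "hcell X f g \<in> cells X [lhom X f g] f g (lid X A)"
proof -
  have "A \<in> Obj X" using assms by auto
  then have "\<exists>\<kappa>. cartesian X \<kappa> \<and> tgt X \<kappa> = lid X A \<and> left X \<kappa> = f \<and> right X \<kappa> = g"
    using assms by (intro restrictions) auto
  from someI_ex[OF this] show "cartesian X (hcell X f g)"
    and "hcell X f g \<in> cells X [lhom X f g] f g (lid X A)"
    using assms by (auto simp: hcell_def lhom_def rcell_def restr_def cells_def cartesian_def)
qed

lemma lhom_in [simp]:
  assumes "f \<in> Tight X" and "g \<in> Tight X" and "tcod X f = tcod X g"
  shows "lhom X f g \<in> Loose X" and "ldom X (lhom X f g) = tdom X g"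
    and "lcod X (lhom X f g) = tdom X f"
  using cells_frame(4)[OF hcell_spec(2)[OF assms(1,2,3) refl]] by auto

text \<open>The passage from 2-cells with identity tight-cells, in which limits and density are
  phrased, to the 2-cells that \<open>hmul\<close> multiplies.\<close>

lemma hcell_bij:
  assumes "f \<in> Tight X" and "g \<in> Tight X" and "tcod X f = A" and "tcod X g = A"
  shows "bij_betw (\<lambda>\<chi>. ccomp X (hcell X f g) (tid X (tdom X f)) [\<chi>])
    (gcells X ps (lhom X f g)) (cells X ps f g (lid X A))"
  using cart_bij[OF hcell_spec[OF assms], of "tid X (tdom X f)" "tid X (tdom X g)" ps] assms
  by (simp add: gcells_def)

lemma hproj_spec:
  assumes "f \<in> Tight X" and "g \<in> Tight X" and "tcod X f = A" and "tcod X g = A"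
    and "f' \<in> Tight X" and "tcod X f' = tdom X f" and "g' \<in> Tight X" and "tcod X g' = tdom X g"
  shows "hproj X f g f' g' \<in> cells X [lhom X (f \<cdot> f') (g \<cdot> g')] f' g' (lhom X f g)"
    and "ccomp X (hcell X f g) f' [hproj X f g f' g'] = hcell X (f \<cdot> f') (g \<cdot> g')"
proof -
  have "hcell X (f \<cdot> f') (g \<cdot> g') \<in> cells X [lhom X (f \<cdot> f') (g \<cdot> g')] (f \<cdot> f') (g \<cdot> g') (lid X A)"
    using assms by (intro hcell_spec(2)) auto
  from factor_spec[OF hcell_spec[OF assms(1-4)] assms(5-8) this]
  show "hproj X f g f' g' \<in> cells X [lhom X (f \<cdot> f') (g \<cdot> g')] f' g' (lhom X f g)"
    and "ccomp X (hcell X f g) f' [hproj X f g f' g'] = hcell X (f \<cdot> f') (g \<cdot> g')"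
    by (auto simp: hproj_def)
qed

text \<open>Cancellation: following it with the cartesian \<open>hcell X f g\<close> gives a
  cartesian 2-cell again, so the first factor is cartesian too.\<close>

lemma hproj_cartesian:
  assumes fg: "f \<in> Tight X" "g \<in> Tight X" "tcod X f = A" "tcod X g = A"
    "f' \<in> Tight X" "tcod X f' = tdom X f" "g' \<in> Tight X" "tcod X g' = tdom X g"
  shows "cartesian X (hproj X f g f' g')"
proof (rule cartesianI[OF hproj_spec(1)[OF fg]])
  fix ps h k
  assume hk: "h \<in> Tight X" "tcod X h = tdom X f'" "k \<in> Tight X" "tcod X k = tdom X g'"
  note P = hproj_spec[OF fg]
  note H = hcell_spec[OF fg(1-4)]
  let ?P = "\<lambda>\<chi>. ccomp X (hproj X f g f' g') h [\<chi>]"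
  let ?H = "\<lambda>\<chi>. ccomp X (hcell X f g) (f' \<cdot> h) [\<chi>]"
  have comp: "(?H \<circ> ?P) \<chi> = ccomp X (hcell X (f \<cdot> f') (g \<cdot> g')) h [\<chi>]"
    if "\<chi> \<in> cells X ps h k (lhom X (f \<cdot> f') (g \<cdot> g'))" for \<chi>
    using ccomp_assoc1[OF H(2) P(1) cpaths_single[OF that]] P(2) hk by simp
  have "bij_betw (\<lambda>\<chi>. ccomp X (hcell X (f \<cdot> f') (g \<cdot> g')) h [\<chi>])
      (cells X ps h k (lhom X (f \<cdot> f') (g \<cdot> g')))
      (cells X ps ((f \<cdot> f') \<cdot> h) ((g \<cdot> g') \<cdot> k) (lid X A))"
    using fg hk by (intro cart_bij hcell_spec) auto
  then have "bij_betw (?H \<circ> ?P) (cells X ps h k (lhom X (f \<cdot> f') (g \<cdot> g')))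
      (cells X ps (f \<cdot> f' \<cdot> h) (g \<cdot> g' \<cdot> k) (lid X A))"
    using comp fg hk by (subst bij_betw_cong[OF comp]) (auto simp: tcomp_assoc')
  moreover have "bij_betw ?H (cells X ps (f' \<cdot> h) (g' \<cdot> k) (lhom X f g))
      (cells X ps (f \<cdot> f' \<cdot> h) (g \<cdot> g' \<cdot> k) (lid X A))"
    using fg hk by (intro cart_bij H) auto
  moreover have "?P ` cells X ps h k (lhom X (f \<cdot> f') (g \<cdot> g')) \<subseteq>
      cells X ps (f' \<cdot> h) (g' \<cdot> k) (lhom X f g)"
    using ccomp1_in[OF P(1)] by blast
  ultimately show "bij_betw ?P (cells X ps h k (lhom X (f \<cdot> f') (g \<cdot> g')))
      (cells X ps (f' \<cdot> h) (g' \<cdot> k) (lhom X f g))"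
    using bij_betw_comp_iff2 by blast
qed

section \<open>Composition and the action of a tight-cell, read in the loose-identity\<close>

text \<open>\<open>cup X c\<close> is by definition a product of two cartesian 2-cells; restricting
  along \<open>x\<close> and \<open>y\<close> replaces each factor by the cartesian 2-cell of the
  restricted loose-cell.\<close>

lemma cup_at_spec:
  assumes "c \<in> Tight X" and "x \<in> Tight X" and "y \<in> Tight X"
    and "tcod X c = B" and "tcod X x = B" and "tcod X y = B"
  shows "cup_at X c x y \<in> gcells X [lhom X x c, lhom X c y] (lhom X x y)"
    and "ccomp X (hcell X x y) (tid X (tdom X x)) [cup_at X c x y] =
      hmul B (hcell X x c) (hcell X c y)"
proof -
  have B: "B \<in> Obj X" using assms by auto
  have t: "tid X B \<in> Tight X" "tcod X (tid X B) = B" using B by auto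
  note h1 = hcell_spec(2)[OF t(1) assms(1) t(2) assms(4)]
  note h2 = hcell_spec(2)[OF assms(1) t(1) assms(4) t(2)]
  have p1: "hproj X (tid X B) c x (tid X (tdom X c)) \<in> cells X [lhom X x c] x (tid X (tdom X c)) (lhom X (tid X B) c)"
    "ccomp X (hcell X (tid X B) c) x [hproj X (tid X B) c x (tid X (tdom X c))] = hcell X x c"
    using hproj_spec[of "tid X B" c B x "tid X (tdom X c)"] assms B by auto
  have p2: "hproj X c (tid X B) (tid X (tdom X c)) y \<in> cells X [lhom X c y] (tid X (tdom X c)) y (lhom X c (tid X B))"
    "ccomp X (hcell X c (tid X B)) (tid X (tdom X c)) [hproj X c (tid X B) (tid X (tdom X c)) y] = hcell X c y"
    using hproj_spec[of c "tid X B" B "tid X (tdom X c)" y] assms B by auto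
  have cup: "cup X c = hmul B (hcell X (tid X B) c) (hcell X c (tid X B))"
    using hmul_eq[OF h1] assms by (simp add: cup_def)
  have "ccomp X (hmul B (hcell X (tid X B) c) (hcell X c (tid X B))) x
      ([hproj X (tid X B) c x (tid X (tdom X c))] @ [hproj X c (tid X B) (tid X (tdom X c)) y]) =
    hmul B (ccomp X (hcell X (tid X B) c) x [hproj X (tid X B) c x (tid X (tdom X c))])
      (ccomp X (hcell X c (tid X B)) (tid X (tdom X c)) [hproj X c (tid X B) (tid X (tdom X c)) y])"
    using assms B by (intro hmul_ccomp[OF B h1 h2 cpaths_single[OF p1(1)] cpaths_single[OF p2(1)]]) auto
  then have eq: "cup_at X c x y = factor X (hcell X x y) (tid X (tdom X x)) (tid X (tdom X y))
      (hmul B (hcell X x c) (hcell X c y))"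
    using assms(4) cup p1(2) p2(2) by (simp add: cup_at_def)
  have "hmul B (hcell X x c) (hcell X c y) \<in> cells X [lhom X x c, lhom X c y] x y (lid X B)"
    using hmul_in[OF B hcell_spec(2) hcell_spec(2)] assms by fastforce
  then have "hmul B (hcell X x c) (hcell X c y) \<in>
      cells X [lhom X x c, lhom X c y] (x \<cdot> tid X (tdom X x)) (y \<cdot> tid X (tdom X y)) (lid X B)"
    using assms by simp
  from factor_spec[OF hcell_spec[OF assms(2,3,5,6)] _ _ _ _ this]
  show "cup_at X c x y \<in> gcells X [lhom X x c, lhom X c y] (lhom X x y)"
    and "ccomp X (hcell X x y) (tid X (tdom X x)) [cup_at X c x y] =
      hmul B (hcell X x c) (hcell X c y)"
    using assms by (auto simp: eq gcells_def)
qed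

text \<open>The 2-cell from \<open>A(1,1)\<close> to \<open>B(1,1)\<close> with both tight-cells \<open>g\<close> that corresponds to the identity of \<open>g\<close>.\<close>

definition act where
  "act g = ccomp X (hcell X g g) (tid X (tdom X g)) [cap1 X g]"

text \<open>\<open>cap X g\<close> is a factorisation through a cartesian 2-cell and
  \<open>cap1 X g\<close> an extension along the unit; composing back undoes both. The second clause
  is the normalisation that \<open>ccomp_runitor\<close> asks of \<open>\<gamma>\<close>.\<close>

lemma cap1_spec:
  assumes g: "g \<in> Tight X" "tdom X g = A" "tcod X g = B"
  shows "cap1 X g \<in> gcells X [lid X A] (lhom X g g)"
    and "ccomp X (act g) (tid X A) [lunit X A] = unit_cell B g"
    and "act g \<in> cells X [lid X A] g g (lid X B)"
proof -
  have AB: "A \<in> Obj X" "B \<in> Obj X" using g by auto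
  note H = hcell_spec[OF g(1) g(1) g(3) g(3)]
  have "unit_cell B g \<in> cells X [] (g \<cdot> tid X A) (g \<cdot> tid X A) (lid X B)"
    using unit_cell_in[OF g(1,3)] g by simp
  from factor_spec[OF H _ _ _ _ this]
  have cap: "cap X g \<in> cells X [] (tid X A) (tid X A) (lhom X g g)"
    "ccomp X (hcell X g g) (tid X A) [cap X g] = unit_cell B g"
    using g AB by (auto simp: cap_def)
  have "\<exists>!\<gamma>. \<gamma> \<in> gcells X [lid X A] (lhom X g g) \<and> ccomp X \<gamma> (tid X A) [lunit X A] = cap X g"
    using unit_ext1[OF AB(1) cap(1)] AB g by (simp add: gcells_def)
  from theI'[OF this] have cap1: "cap1 X g \<in> gcells X [lid X A] (lhom X g g)"
    "ccomp X (cap1 X g) (tid X A) [lunit X A] = cap X g"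
    using g by (auto simp: cap1_def)
  then have c: "cap1 X g \<in> cells X [lid X A] (tid X A) (tid X A) (lhom X g g)"
    using g by (simp add: gcells_def)
  show "cap1 X g \<in> gcells X [lid X A] (lhom X g g)" by (rule cap1)
  show "act g \<in> cells X [lid X A] g g (lid X B)"
    using ccomp1_in[OF H(2) c] g AB by (simp add: act_def)
  show "ccomp X (act g) (tid X A) [lunit X A] = unit_cell B g"
    using ccomp_assoc1[OF H(2) c cpaths_single[OF lunit_in[OF AB(1)]]] g AB cap(2) cap1(2)
    by (simp add: act_def)
qed

text \<open>\<open>hcell X g g\<close> after \<open>hproj X g g x y\<close> is the cartesian 2-cell
  of the target, so the factorisation defining \<open>cap_at\<close> is undone and only
  \<open>act g\<close> remains.\<close>

lemma cap_at_spec: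
  assumes "g \<in> Tight X" "tdom X g = A" "tcod X g = B"
    and "x \<in> Tight X" "tcod X x = A" and "y \<in> Tight X" "tcod X y = A"
  shows "cap_at X g x y \<in> gcells X [lhom X x y] (lhom X (g \<cdot> x) (g \<cdot> y))"
    and "ccomp X (hcell X (g \<cdot> x) (g \<cdot> y)) (tid X (tdom X x)) [cap_at X g x y] =
      ccomp X (act g) x [hcell X x y]"
proof -
  have AB: "A \<in> Obj X" "B \<in> Obj X" using assms by auto
  note fr = assms(1,1,3,3) assms(4) assms(5)[folded assms(2)] assms(6) assms(7)[folded assms(2)]
  note P = hproj_spec[OF fr]
  have tx: "tid X (tdom X x) \<in> Tight X" "tcod X (tid X (tdom X x)) = tdom X x"
    and ty: "tid X (tdom X y) \<in> Tight X" "tcod X (tid X (tdom X y)) = tdom X y"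
    using assms by auto
  note H = hcell_spec[OF assms(1,1,3,3)]
  note h = hcell_spec(2)[OF assms(4,6,5,7)]
  have c: "cap1 X g \<in> cells X [lid X A] (tid X A) (tid X A) (lhom X g g)"
    using cap1_spec(1)[OF assms(1-3)] assms by (simp add: gcells_def)
  have "ccomp X (cap1 X g) x [hcell X x y] \<in>
      cells X [lhom X x y] (x \<cdot> tid X (tdom X x)) (y \<cdot> tid X (tdom X y)) (lhom X g g)"
    using ccomp1_in[OF c h] assms by simp
  note F = factor_spec[OF hproj_cartesian[OF fr] P(1) tx ty this, folded cap_at_def]
  show "cap_at X g x y \<in> gcells X [lhom X x y] (lhom X (g \<cdot> x) (g \<cdot> y))"
    using F(1) assms by (simp add: gcells_def)
  have "ccomp X (hcell X (g \<cdot> x) (g \<cdot> y)) (tid X (tdom X x)) [cap_at X g x y] =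
    ccomp X (ccomp X (hcell X g g) x [hproj X g g x y]) (tid X (tdom X x)) [cap_at X g x y]"
    by (simp add: P(2))
  also have "\<dots> = ccomp X (hcell X g g) x [ccomp X (hproj X g g x y) (tid X (tdom X x)) [cap_at X g x y]]"
    using ccomp_assoc1[OF H(2) P(1) cpaths_single[OF F(1)]] assms by simp
  also have "\<dots> = ccomp X (hcell X g g) x [ccomp X (cap1 X g) x [hcell X x y]]" by (simp add: F(2))
  also have "\<dots> = ccomp X (act g) x [hcell X x y]"
    using ccomp_assoc1[OF H(2) c cpaths_single[OF h]] assms AB by (simp add: act_def)
  finally show "ccomp X (hcell X (g \<cdot> x) (g \<cdot> y)) (tid X (tdom X x)) [cap_at X g x y] =
      ccomp X (act g) x [hcell X x y]" .
qed

section \<open>Unitors turned into multiplication\<close>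

text \<open>Inserting the unit into the last slot gives \<open>\<kappa>\<close> on both sides: on
  the left by the definition of the unitor, on the right because \<open>\<gamma>\<close> sends the
  unit to an identity arrow.\<close>

lemma ccomp_runitor:
  assumes \<kappa>: "\<kappa> \<in> cells X [p] x g (lid X E)" and E: "E \<in> Obj X"
    and \<gamma>: "\<gamma> \<in> cells X [lid X B] g g (lid X E)" and B: "B \<in> Obj X"
    and unit: "ccomp X \<gamma> (tid X B) [lunit X B] = unit_cell E g"
  shows "ccomp X \<kappa> (tid X (tdom X x)) [runitor X p] = hmul E \<kappa> \<gamma>"
proof (rule unit_cancel[OF B, of _ "[p]"])
  let ?i = "tid X (tdom X x)"
  have g: "tdom X g = B" using cells_frame(4)[OF \<gamma>] unfolding chain.simps lid_in[OF B] by blast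
  then have p: "p \<in> Loose X" "ldom X p = B" "lcod X p = tdom X x" using cells_frame(4)[OF \<kappa>] by auto
  have x: "x \<in> Tight X" "tdom X x \<in> Obj X" using cells_frame(1)[OF \<kappa>] by auto
  have gT: "g \<in> Tight X" using cells_frame(2)[OF \<kappa>] .
  note \<rho> = runitor_spec[OF p]
  have c: "cid X p \<in> cells X [p] ?i (tid X B) p" using cid_in[OF p(1)] p by simp
  note u = lunit_in[OF B]
  show "ccomp X \<kappa> ?i [runitor X p] \<in> cells X ([p] @ [lid X B]) x g (lid X E)"
    using ccomp1_in[OF \<kappa> \<rho>(1)] x gT g by simp
  show "hmul E \<kappa> \<gamma> \<in> cells X ([p] @ [lid X B]) x g (lid X E)" by (rule hmul_in[OF E \<kappa> \<gamma>])
  have "ccomp X (ccomp X \<kappa> ?i [runitor X p]) ?i [cid X p, lunit X B] =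
    ccomp X \<kappa> ?i [ccomp X (runitor X p) ?i [cid X p, lunit X B]]"
    using x by (subst ccomp_assoc1[OF \<kappa> \<rho>(1) cpaths_pair[OF c u]]) auto
  also have "\<dots> = \<kappa>" using ccomp_cid_right[OF \<kappa>] by (simp add: \<rho>(2))
  also have "\<dots> = hmul E (ccomp X \<kappa> ?i [cid X p]) (ccomp X \<gamma> (tid X B) [lunit X B])"
    using ccomp_cid_right[OF \<kappa> refl] hmul_unit_right[OF E \<kappa>] by (simp add: unit)
  also have "\<dots> = ccomp X (hmul E \<kappa> \<gamma>) ?i ([cid X p] @ [lunit X B])"
    using x by (intro hmul_ccomp[OF E \<kappa> \<gamma> cpaths_single[OF c] cpaths_single[OF u], symmetric]) auto
  finally show "ccomp X (ccomp X \<kappa> ?i [runitor X p]) ?i (map (cid X) [p] @ [lunit X B]) =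
      ccomp X (hmul E \<kappa> \<gamma>) ?i (map (cid X) [p] @ [lunit X B])"
    by simp
qed

text \<open>One operation on \<open>\<chi>\<close>, absorbing \<open>\<nu>\<close> through the
  unitor of \<open>p\<close>, thus becomes right multiplication by \<open>\<nu>\<close> or by its
  image under a tight-cell, according to the choice of \<open>\<kappa>\<close> and
  \<open>\<gamma>\<close>. This compares the two sides of a relative adjunction.\<close>

lemma ccomp_runitor_ccomp:
  assumes \<kappa>: "\<kappa> \<in> cells X [p] x g (lid X E)" and E: "E \<in> Obj X"
    and \<gamma>: "\<gamma> \<in> cells X [lid X B] g g (lid X E)" and B: "B \<in> Obj X"
    and unit: "ccomp X \<gamma> (tid X B) [lunit X B] = unit_cell E g"
    and \<chi>: "\<chi> \<in> cells X qs a y p" and \<nu>: "\<nu> \<in> cells X ps y z (lid X B)"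
  shows "ccomp X \<kappa> a [ccomp X (runitor X p) a [\<chi>, \<nu>]] = hmul E (ccomp X \<kappa> a [\<chi>]) (ccomp X \<gamma> y [\<nu>])"
proof -
  have "tdom X g = B" using cells_frame(4)[OF \<gamma>] unfolding chain.simps lid_in[OF B] by blast
  then have p: "p \<in> Loose X" "ldom X p = B" "lcod X p = tdom X x" using cells_frame(4)[OF \<kappa>] by auto
  have a: "a \<in> Tight X" "tcod X a = tdom X x" using cells_frame[OF \<chi>] p by auto
  have x: "x \<in> Tight X" "tdom X x \<in> Obj X" using cells_frame(1)[OF \<kappa>] by auto
  note \<rho> = runitor_spec[OF p]
  have "ccomp X \<kappa> a [ccomp X (runitor X p) a [\<chi>, \<nu>]] =
    ccomp X (ccomp X \<kappa> (tid X (tdom X x)) [runitor X p]) a [\<chi>, \<nu>]"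
    using a x by (subst ccomp_assoc1[OF \<kappa> \<rho>(1) cpaths_pair[OF \<chi> \<nu>]]) auto
  also have "\<dots> = ccomp X (hmul E \<kappa> \<gamma>) a ([\<chi>] @ [\<nu>])"
    by (simp add: ccomp_runitor[OF \<kappa> E \<gamma> B unit])
  also have "\<dots> = hmul E (ccomp X \<kappa> a [\<chi>]) (ccomp X \<gamma> y [\<nu>])"
    by (rule hmul_ccomp[OF E \<kappa> \<gamma> cpaths_single[OF \<chi>] cpaths_single[OF \<nu>] a(2)])
  finally show ?thesis .
qed

lemma ccomp_runitor_cid:
  assumes \<kappa>: "\<kappa> \<in> cells X [p] x (tid X E) (lid X E)" and E: "E \<in> Obj X"
    and \<chi>: "\<chi> \<in> cells X qs a y p" and \<nu>: "\<nu> \<in> cells X ps y z (lid X E)"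
  shows "ccomp X \<kappa> a [ccomp X (runitor X p) a [\<chi>, \<nu>]] = hmul E (ccomp X \<kappa> a [\<chi>]) \<nu>"
  using ccomp_runitor_ccomp[OF \<kappa> E lid_cid_in[OF E] E _ \<chi> \<nu>]
  by (simp add: ccomp_cid_left[OF lunit_in[OF E]] ccomp_cid_left[OF \<nu>] unit_cell_tid[OF E])

section \<open>Units of companions and conjoints\<close>

lemma companion_unit:
  assumes "x \<in> Tight X" and "tcod X x = B"
  obtains u where "u \<in> cells X [] x (tid X (tdom X x)) (lhom X (tid X B) x)"
    and "ccomp X (hcell X (tid X B) x) x [u] = unit_cell B x"
proof -
  have t: "tid X B \<in> Tight X" "tcod X (tid X B) = B" using assms by auto
  \<comment> \<open>The frame \<open>x\<close>, \<open>x\<close> is read as \<open>1 x\<close> on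
    the left and \<open>x 1\<close> on the right, to fit the cartesian 2-cell of
    \<open>B(1,x)\<close>; for the conjoint the roles are exchanged.\<close>
  have "unit_cell B x \<in> cells X [] (tid X B \<cdot> x) (x \<cdot> tid X (tdom X x)) (lid X B)"
    using unit_cell_in[OF assms] assms by simp
  from factor_spec[OF hcell_spec[OF t(1) assms(1) t(2) assms(2)] _ _ _ _ this] show ?thesis
    using assms that by auto
qed

lemma conjoint_unit:
  assumes "x \<in> Tight X" and "tcod X x = B"
  obtains v where "v \<in> cells X [] (tid X (tdom X x)) x (lhom X x (tid X B))"
    and "ccomp X (hcell X x (tid X B)) (tid X (tdom X x)) [v] = unit_cell B x"
proof -
  have t: "tid X B \<in> Tight X" "tcod X (tid X B) = B" using assms by auto
  have "unit_cell B x \<in> cells X [] (x \<cdot> tid X (tdom X x)) (tid X B \<cdot> x) (lid X B)"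
    using unit_cell_in[OF assms] assms by simp
  from factor_spec[OF hcell_spec[OF assms(1) t(1) assms(2) t(2)] _ _ _ _ this] show ?thesis
    using assms that by auto
qed

section \<open>Limits, density and relative adjunctions\<close>

text \<open>The cartesian 2-cells of \<open>B(1,c)\<close> and \<open>B(1,f)\<close> conjugate the
  factorisation map of the right extension to right multiplication by \<open>\<nu>\<close>, since
  \<open>cup_at\<close> becomes a product of cartesian 2-cells.\<close>

lemma limiting_iff:
  assumes cone: "cone X p f c \<mu>" and B: "tcod X f = B"
    and \<nu>_def: "\<nu> = ccomp X (hcell X c f) (tid X (lcod X p)) [\<mu>]"
  shows "limiting X p f c \<mu> \<longleftrightarrow>
    (\<forall>rs. chain X B rs (lcod X p) \<longrightarrow>
      bij_betw (\<lambda>\<alpha>. hmul B \<alpha> \<nu>) (cells X rs (tid X B) c (lid X B))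
        (cells X (rs @ [p]) (tid X B) f (lid X B)))"
proof -
  have p: "p \<in> Loose X" and f: "f \<in> Tight X" "tdom X f = ldom X p"
    and c: "c \<in> Tight X" "tdom X c = lcod X p" "tcod X c = B"
    and \<mu>: "\<mu> \<in> cells X [p] (tid X (lcod X p)) (tid X (ldom X p)) (lhom X c f)"
    using cone B by (auto simp: cone_def tights_def gcells_def)
  have BO: "B \<in> Obj X" using f B by auto
  have t: "tid X B \<in> Tight X" "tcod X (tid X B) = B" "tdom X (tid X B) = B" using BO by auto
  let ?s = "lhom X (tid X B) c" and ?q = "lhom X (tid X B) f" and ?cup = "cup_at X c (tid X B) f"
  let ?w = "ccomp X ?cup (tid X B) [cid X ?s, \<mu>]"
  have s: "?s \<in> Loose X" "lcod X ?s = B" "ldom X ?s = lcod X p"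
    and q: "?q \<in> Loose X" "lcod X ?q = B" "ldom X ?q = ldom X p" using t c f B by auto
  note h1c = hcell_spec[OF t(1) c(1) t(2) c(3)] and h1f = hcell_spec[OF t(1) f(1) t(2) B]
    and hcf = hcell_spec[OF c(1) f(1) c(3) B]
  have cup: "?cup \<in> cells X [?s, lhom X c f] (tid X B) (tid X (ldom X p)) ?q"
    "ccomp X (hcell X (tid X B) f) (tid X B) [?cup] = hmul B (hcell X (tid X B) c) (hcell X c f)"
    using cup_at_spec[OF c(1) t(1) f(1) c(3) t(2) B] q t by (auto simp: gcells_def)
  have cs: "cid X ?s \<in> cells X [?s] (tid X B) (tid X (lcod X p)) ?s" using cid_in[OF s(1)] s by simp
  have w: "?w \<in> cells X [?s, p] (tid X B) (tid X (ldom X p)) ?q"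
    using ccomp2_in[OF cup(1) cs \<mu>] t p by simp
  have \<nu>: "\<nu> \<in> cells X [p] c f (lid X B)"
    using ccomp1_in[OF hcf(2) \<mu>] c f by (simp add: \<nu>_def)
  have main: "bij_betw (\<lambda>\<psi>. ccomp X ?w (tid X B) [\<psi>, cid X p]) (gcells X rs ?s) (gcells X (rs @ [p]) ?q) \<longleftrightarrow>
      bij_betw (\<lambda>\<alpha>. hmul B \<alpha> \<nu>) (cells X rs (tid X B) c (lid X B))
        (cells X (rs @ [p]) (tid X B) f (lid X B))"
    and W: "(\<lambda>\<psi>. ccomp X ?w (tid X B) [\<psi>, cid X p]) ` gcells X rs ?s \<subseteq> gcells X (rs @ [p]) ?q" for rs
  proof -
    have \<psi>: "\<psi> \<in> cells X rs (tid X B) (tid X (lcod X p)) ?s" if "\<psi> \<in> gcells X rs ?s" for \<psi>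
      using that s by (simp add: gcells_def)
    have cp: "cid X p \<in> cells X [p] (tid X (lcod X p)) (tid X (ldom X p)) p" by (rule cid_in[OF p])
    \<comment> \<open>Associativity absorbs the identities: \<open>\<psi>\<close> is composed into
      the identity of \<open>?s\<close>, and the identity of \<open>p\<close> into
      \<open>\<mu>\<close>.\<close>
    have eq: "ccomp X ?w (tid X B) [\<psi>, cid X p] = ccomp X ?cup (tid X B) [\<psi>, \<mu>]"
      if "\<psi> \<in> gcells X rs ?s" for \<psi>
    proof -
      have "ccomp X ?w (tid X B) ([\<psi>] @ [cid X p]) =
        ccomp X ?cup (tid X B \<cdot> tid X B) [ccomp X (cid X ?s) (tid X B) [\<psi>], ccomp X \<mu> (tid X (lcod X p)) [cid X p]]"
        using t by (intro ccomp_assoc2[OF cup(1) cs \<mu> cpaths_single[OF \<psi>[OF that]] cpaths_single[OF cp]]) auto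
      then show ?thesis
        using ccomp_cid_left[OF \<psi>[OF that]] ccomp_cid_right[OF \<mu>, of "lcod X p"] t p by simp
    qed
    show W: "(\<lambda>\<psi>. ccomp X ?w (tid X B) [\<psi>, cid X p]) ` gcells X rs ?s \<subseteq> gcells X (rs @ [p]) ?q"
      using ccomp2_in[OF cup(1) \<psi> \<mu>] t p q eq by (auto simp: gcells_def)
    show "bij_betw (\<lambda>\<psi>. ccomp X ?w (tid X B) [\<psi>, cid X p]) (gcells X rs ?s) (gcells X (rs @ [p]) ?q) \<longleftrightarrow>
      bij_betw (\<lambda>\<alpha>. hmul B \<alpha> \<nu>) (cells X rs (tid X B) c (lid X B))
        (cells X (rs @ [p]) (tid X B) f (lid X B))"
    proof (rule bij_betw_conjugate[OF _ _ W])
      show "bij_betw (\<lambda>\<chi>. ccomp X (hcell X (tid X B) c) (tid X B) [\<chi>]) (gcells X rs ?s)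
          (cells X rs (tid X B) c (lid X B))"
        using hcell_bij[OF t(1) c(1) t(2) c(3)] t by simp
      show "bij_betw (\<lambda>\<chi>. ccomp X (hcell X (tid X B) f) (tid X B) [\<chi>]) (gcells X (rs @ [p]) ?q)
          (cells X (rs @ [p]) (tid X B) f (lid X B))"
        using hcell_bij[OF t(1) f(1) t(2) B] t by simp
      show "(\<lambda>\<alpha>. hmul B \<alpha> \<nu>) ` cells X rs (tid X B) c (lid X B) \<subseteq>
          cells X (rs @ [p]) (tid X B) f (lid X B)"
        using hmul_in[OF BO _ \<nu>] by blast
      fix \<psi> assume a: "\<psi> \<in> gcells X rs ?s"
      have "ccomp X (hcell X (tid X B) f) (tid X B) [ccomp X ?cup (tid X B) [\<psi>, \<mu>]] =
        ccomp X (hmul B (hcell X (tid X B) c) (hcell X c f)) (tid X B) [\<psi>, \<mu>]"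
        using ccomp_assoc1[OF h1f(2) cup(1) cpaths_pair[OF \<psi>[OF a] \<mu>]] t by (simp add: cup(2))
      also have "\<dots> = hmul B (ccomp X (hcell X (tid X B) c) (tid X B) [\<psi>]) \<nu>"
        using hmul_ccomp[OF BO h1c(2) hcf(2) cpaths_single[OF \<psi>[OF a]] cpaths_single[OF \<mu>]] t
        by (simp add: \<nu>_def)
      finally show "ccomp X (hcell X (tid X B) f) (tid X B) [ccomp X ?w (tid X B) [\<psi>, cid X p]] =
          hmul B (ccomp X (hcell X (tid X B) c) (tid X B) [\<psi>]) \<nu>"
        by (simp add: eq[OF a])
    qed
  qed
  have "limiting X p f c \<mu> \<longleftrightarrow> right_extension X ?q p ?s ?w"
    using cone B by (simp add: limiting_def Let_def)
  also have "\<dots> \<longleftrightarrow> (\<forall>rs. chain X B rs (lcod X p) \<longrightarrow>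
      bij_betw (\<lambda>\<psi>. ccomp X ?w (tid X B) [\<psi>, cid X p]) (gcells X rs ?s) (gcells X (rs @ [p]) ?q))"
    using p q s w bij_betw_iff_ex1[OF W] by (simp add: right_extension_def looses_def gcells_def)
  finally show ?thesis using main by simp
qed

text \<open>
  Whiskering with the companion \<open>B(1,x)\<close> on the left, where its unit provides a retraction, replaces
  the identity by an arbitrary left tight-cell.
\<close>

lemma hmul_bij_left:
  assumes B: "B \<in> Obj X" and \<nu>: "\<nu> \<in> cells X [p] c f (lid X B)"
    and bij: "\<And>rs. chain X B rs (lcod X p) \<Longrightarrow>
      bij_betw (\<lambda>\<alpha>. hmul B \<alpha> \<nu>) (cells X rs (tid X B) c (lid X B))
        (cells X (rs @ [p]) (tid X B) f (lid X B))"
    and x: "x \<in> Tight X" "tcod X x = B" and rs: "chain X (tdom X x) rs (lcod X p)"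
  shows "bij_betw (\<lambda>\<alpha>. hmul B \<alpha> \<nu>) (cells X rs x c (lid X B)) (cells X (rs @ [p]) x f (lid X B))"
proof -
  let ?h = "hcell X (tid X B) x" and ?q = "lhom X (tid X B) x"
  obtain u where u: "u \<in> cells X [] x (tid X (tdom X x)) ?q" "ccomp X ?h x [u] = unit_cell B x"
    using companion_unit[OF x] .
  have t: "tid X B \<in> Tight X" "tcod X (tid X B) = B" "tdom X (tid X B) = B" using B by auto
  have h: "?h \<in> cells X [?q] (tid X B) x (lid X B)" by (rule hcell_spec(2)[OF t(1) x(1) t(2) x(2)])
  have p: "p \<in> Loose X" "lcod X p = tdom X c" "ldom X p = tdom X f"
    using cells_frame(4)[OF \<nu>] by auto
  have rsp: "chain X (tdom X x) (rs @ [p]) (ldom X p)" using rs p(1) by (auto simp: chain_append)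
  \<comment> \<open>Precomposition with \<open>u\<close> turns the factor \<open>?h\<close> into the
    identity arrow at \<open>x\<close>, undoing the whiskering.\<close>
  have retract: "ccomp X (hmul B ?h \<alpha>) x (u # map (cid X) qs) = \<alpha>"
    if \<alpha>: "\<alpha> \<in> cells X qs x z (lid X B)" for \<alpha> qs z
    using hmul_ccomp[OF B h \<alpha> cpaths_single[OF u(1)] cpaths_cid[OF cells_frame(4)[OF \<alpha>]]]
      ccomp_cid_right[OF \<alpha> refl] hmul_unit_left[OF B \<alpha>] u(2) x(2) t by simp
  have path: "u # map (cid X) qs \<in> cpaths qs x (tid X W) (?q # qs)" if "chain X (tdom X x) qs W" for qs W
    using cpaths_Cons[OF u(1) cpaths_cid[OF that]] by simp
  show ?thesis
  proof (rule bij_betw_retract)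
    \<comment> \<open>The hypothesis is applied to the chain \<open>?q # rs\<close>, which ends at
      \<open>B\<close>.\<close>
    show "bij_betw (\<lambda>\<alpha>. hmul B \<alpha> \<nu>) (cells X (?q # rs) (tid X B) c (lid X B))
        (cells X ((?q # rs) @ [p]) (tid X B) f (lid X B))"
      using rs x t by (intro bij) auto
    show "hmul B ?h ` cells X rs x c (lid X B) \<subseteq> cells X (?q # rs) (tid X B) c (lid X B)"
      using hmul_in[OF B h] by fastforce
    show "hmul B ?h ` cells X (rs @ [p]) x f (lid X B) \<subseteq> cells X ((?q # rs) @ [p]) (tid X B) f (lid X B)"
      using hmul_in[OF B h] by fastforce
    show "(\<lambda>\<alpha>. ccomp X \<alpha> x (u # map (cid X) rs)) ` cells X (?q # rs) (tid X B) c (lid X B)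
        \<subseteq> cells X rs x c (lid X B)"
      using ccomp_in[OF _ path[OF rs]] x t p cells_frame(1)[OF \<nu>] by fastforce
    show "(\<lambda>\<alpha>. hmul B \<alpha> \<nu>) ` cells X rs x c (lid X B) \<subseteq> cells X (rs @ [p]) x f (lid X B)"
      using hmul_in[OF B _ \<nu>] by blast
    show "ccomp X (hmul B ?h \<alpha>) x (u # map (cid X) rs) = \<alpha>" if "\<alpha> \<in> cells X rs x c (lid X B)" for \<alpha>
      by (rule retract[OF that])
    show "ccomp X (hmul B ?h \<alpha>) x (u # map (cid X) (rs @ [p])) = \<alpha>"
      if "\<alpha> \<in> cells X (rs @ [p]) x f (lid X B)" for \<alpha>
      by (rule retract[OF that])
    show "hmul B (hmul B ?h \<alpha>) \<nu> = hmul B ?h (hmul B \<alpha> \<nu>)" if "\<alpha> \<in> cells X rs x c (lid X B)" for \<alpha>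
      by (rule hmul_assoc[OF B h that \<nu>])
    \<comment> \<open>The unit \<open>u\<close> touches the left factor only; above
      \<open>\<nu>\<close> there is an identity.\<close>
    show "hmul B (ccomp X \<alpha> x (u # map (cid X) rs)) \<nu> =
        ccomp X (hmul B \<alpha> \<nu>) x (u # map (cid X) (rs @ [p]))"
      if \<alpha>: "\<alpha> \<in> cells X (?q # rs) (tid X B) c (lid X B)" for \<alpha>
      using hmul_ccomp[OF B \<alpha> \<nu> path[OF rs] cpaths_single[OF cid_in[OF p(1)]]] p(2)
        ccomp_cid_right[OF \<nu>, of "lcod X p"] t x by simp
  qed
qed

text \<open>
  Density only concerns chains from \<open>E\<close> to \<open>E\<close>. Whiskering with the conjoint \<open>E(y,1)\<close> on the right turns
  a chain from the domain of \<open>y\<close> into such a chain.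
\<close>

lemma dense_bij:
  assumes j: "j \<in> Tight X" "tcod X j = E" and dense: "dense X j"
    and y: "y \<in> Tight X" "tcod X y = E" and rs: "chain X E rs (tdom X y)"
  shows "bij_betw (hmul E (hcell X j (tid X E))) (cells X rs (tid X E) y (lid X E))
    (cells X (lhom X j (tid X E) # rs) j y (lid X E))"
proof -
  let ?A = "tdom X j" and ?h = "hcell X j (tid X E)" and ?p = "lhom X j (tid X E)"
  let ?k = "hcell X y (tid X E)" and ?q = "lhom X y (tid X E)"
  have E: "E \<in> Obj X" using j by auto
  have t: "tid X E \<in> Tight X" "tcod X (tid X E) = E" "tdom X (tid X E) = E" using E by auto
  note h = hcell_spec(2)[OF j(1) t(1) j(2) t(2)] and k = hcell_spec(2)[OF y(1) t(1) y(2) t(2)]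
  have p: "?p \<in> Loose X" "lcod X ?p = ?A" "ldom X ?p = E" using j t by auto
  have cp: "cid X ?p \<in> cells X [?p] (tid X ?A) (tid X E) ?p" using cid_in[OF p(1)] p by simp
  note \<rho> = runitor_spec[OF p(1,3,2)]
  have A: "?A \<in> Obj X" using j by auto
  \<comment> \<open>For right tight-cell \<open>1\<close> this is density, conjugated by the
    cartesian 2-cell of \<open>E(j,1)\<close>, through which the unitor becomes left multiplication
    by \<open>?h\<close>.\<close>
  have bij1: "bij_betw (hmul E ?h) (cells X rs (tid X E) (tid X E) (lid X E))
    (cells X (?p # rs) j (tid X E) (lid X E))" if rs: "chain X E rs E" for rs
  proof -
    let ?W = "\<lambda>\<phi>. ccomp X (runitor X ?p) (tid X ?A) [cid X ?p, \<phi>]"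
    have W: "bij_betw ?W (cells X rs (tid X E) (tid X E) (lid X E)) (gcells X (?p # rs) ?p)"
      using dense rs j E by (simp add: dense_def Let_def gcells_def)
    show ?thesis
    proof (subst bij_betw_conjugate[symmetric])
      show "bij_betw id (cells X rs (tid X E) (tid X E) (lid X E)) (cells X rs (tid X E) (tid X E) (lid X E))"
        by simp
      show "bij_betw (\<lambda>\<chi>. ccomp X ?h (tid X ?A) [\<chi>]) (gcells X (?p # rs) ?p) (cells X (?p # rs) j (tid X E) (lid X E))"
        using hcell_bij[OF j(1) t(1) j(2) t(2)] .
      show "?W ` cells X rs (tid X E) (tid X E) (lid X E) \<subseteq> gcells X (?p # rs) ?p"
        using W by (auto simp: bij_betw_def)
      show "hmul E ?h ` cells X rs (tid X E) (tid X E) (lid X E) \<subseteq> cells X (?p # rs) j (tid X E) (lid X E)"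
        using hmul_in[OF E h] by fastforce
      show "ccomp X ?h (tid X ?A) [?W \<phi>] = hmul E ?h (id \<phi>)"
        if "\<phi> \<in> cells X rs (tid X E) (tid X E) (lid X E)" for \<phi>
        using ccomp_runitor_cid[OF h E cp that] ccomp_cid_right[OF h, of ?A] by simp
      show "bij_betw ?W (cells X rs (tid X E) (tid X E) (lid X E)) (gcells X (?p # rs) ?p)" by (rule W)
    qed
  qed
  obtain v where v: "v \<in> cells X [] (tid X (tdom X y)) y ?q"
    "ccomp X ?k (tid X (tdom X y)) [v] = unit_cell E y"
    using conjoint_unit[OF y] .
  have path: "map (cid X) qs @ [v] \<in> cpaths qs (tid X W) y (qs @ [?q])" if "chain X W qs (tdom X y)" for qs W
    using cpaths_append[OF cpaths_cid[OF that] cpaths_single[OF v(1)]] by simp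
  \<comment> \<open>The unit \<open>v\<close> of the conjoint turns the right factor
    \<open>?k\<close> into the identity arrow at \<open>y\<close>.\<close>
  have retract: "ccomp X (hmul E \<alpha> ?k) (tid X (tdom X x)) (map (cid X) qs @ [v]) = \<alpha>"
    if \<alpha>: "\<alpha> \<in> cells X qs x y (lid X E)" for \<alpha> qs x
    using hmul_ccomp[OF E \<alpha> k cpaths_cid[OF cells_frame(4)[OF \<alpha>]] cpaths_single[OF v(1)]]
      ccomp_cid_right[OF \<alpha> refl] hmul_unit_right[OF E \<alpha>] v(2) cells_frame(1)[OF \<alpha>] by simp
  show ?thesis
  proof (rule bij_betw_retract)
    \<comment> \<open>Appending \<open>E(y,1)\<close> makes the chain start at \<open>E\<close>
      again, as \<open>bij1\<close> requires.\<close>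
    show "bij_betw (hmul E ?h) (cells X (rs @ [?q]) (tid X E) (tid X E) (lid X E))
        (cells X (?p # rs @ [?q]) j (tid X E) (lid X E))"
      using rs y t E by (intro bij1) (auto simp: chain_append)
    show "(\<lambda>\<alpha>. hmul E \<alpha> ?k) ` cells X rs (tid X E) y (lid X E) \<subseteq>
        cells X (rs @ [?q]) (tid X E) (tid X E) (lid X E)"
      using hmul_in[OF E _ k] by blast
    show "(\<lambda>\<alpha>. hmul E \<alpha> ?k) ` cells X (?p # rs) j y (lid X E) \<subseteq>
        cells X (?p # rs @ [?q]) j (tid X E) (lid X E)"
      using hmul_in[OF E _ k] by fastforce
    show "(\<lambda>\<alpha>. ccomp X \<alpha> (tid X E) (map (cid X) rs @ [v])) ` cells X (rs @ [?q]) (tid X E) (tid X E) (lid X E)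
        \<subseteq> cells X rs (tid X E) y (lid X E)"
      using ccomp_in[OF _ path[OF rs]] t y by fastforce
    show "hmul E ?h ` cells X rs (tid X E) y (lid X E) \<subseteq> cells X (?p # rs) j y (lid X E)"
      using hmul_in[OF E h] by fastforce
    show "ccomp X (hmul E \<alpha> ?k) (tid X E) (map (cid X) rs @ [v]) = \<alpha>"
      if "\<alpha> \<in> cells X rs (tid X E) y (lid X E)" for \<alpha>
      using retract[OF that] t by simp
    show "ccomp X (hmul E \<alpha> ?k) (tid X ?A) (map (cid X) (?p # rs) @ [v]) = \<alpha>"
      if "\<alpha> \<in> cells X (?p # rs) j y (lid X E)" for \<alpha>
      by (rule retract[OF that])
    show "hmul E ?h (hmul E \<alpha> ?k) = hmul E (hmul E ?h \<alpha>) ?k" if "\<alpha> \<in> cells X rs (tid X E) y (lid X E)" for \<alpha>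
      by (rule hmul_assoc[OF E h that k, symmetric])
    show "hmul E ?h (ccomp X \<alpha> (tid X E) (map (cid X) rs @ [v])) =
        ccomp X (hmul E ?h \<alpha>) (tid X ?A) (map (cid X) (?p # rs) @ [v])"
      if \<alpha>: "\<alpha> \<in> cells X (rs @ [?q]) (tid X E) (tid X E) (lid X E)" for \<alpha>
      using hmul_ccomp[OF E h \<alpha> cpaths_single[OF cp] path[OF rs]] ccomp_cid_right[OF h, of ?A] A by simp
  qed
qed

section \<open>Multiplication across a relative adjunction\<close>

lemma loose_iso_bij:
  assumes iso: "loose_iso X \<phi> p q" and x: "x \<in> Tight X" "tcod X x = lcod X p"
  shows "bij_betw (\<lambda>\<chi>. ccomp X \<phi> x [\<chi>]) (cells X rs x y p) (cells X rs x y q)"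
proof -
  obtain \<psi> where \<phi>': "\<phi> \<in> gcells X [p] q" and \<psi>': "\<psi> \<in> gcells X [q] p"
    and inv: "ccomp X \<psi> (tid X (lcod X p)) [\<phi>] = cid X p" "ccomp X \<phi> (tid X (lcod X q)) [\<psi>] = cid X q"
    using iso by (auto simp: loose_iso_def)
  have fr: "p \<in> Loose X" "q \<in> Loose X" "lcod X p = lcod X q" "ldom X p = ldom X q"
    using cells_frame[OF \<phi>'[unfolded gcells_def]] cells_frame[OF \<psi>'[unfolded gcells_def]] by auto
  have \<phi>: "\<phi> \<in> cells X [p] (tid X (lcod X p)) (tid X (ldom X p)) q"
    and \<psi>: "\<psi> \<in> cells X [q] (tid X (lcod X p)) (tid X (ldom X p)) p"
    using \<phi>' \<psi>' fr by (auto simp: gcells_def)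
  have t: "tid X (lcod X p) \<cdot> x = x" "tdom X (tid X (lcod X p)) = lcod X p" using x fr by auto
  \<comment> \<open>As \<open>y\<close> is arbitrary, its codomain is read off from the frame of a
    2-cell in one of the two sets.\<close>
  have y: "tid X (ldom X p) \<cdot> y = y" if "\<chi> \<in> cells X rs x y p \<or> \<chi> \<in> cells X rs x y q" for \<chi>
    using cells_frame[of \<chi> rs x y] that fr by auto
  show ?thesis
  proof (rule bij_betw_byWitness[where f' = "\<lambda>\<chi>. ccomp X \<psi> x [\<chi>]"])
    show "\<forall>\<chi>\<in>cells X rs x y p. ccomp X \<psi> x [ccomp X \<phi> x [\<chi>]] = \<chi>"
      using ccomp_assoc1[OF \<psi> \<phi> cpaths_single] inv(1) x t ccomp_cid_left by auto
    show "\<forall>\<chi>\<in>cells X rs x y q. ccomp X \<phi> x [ccomp X \<psi> x [\<chi>]] = \<chi>"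
      using ccomp_assoc1[OF \<phi> \<psi> cpaths_single] inv(2) x t ccomp_cid_left fr by auto
    show "(\<lambda>\<chi>. ccomp X \<phi> x [\<chi>]) ` cells X rs x y p \<subseteq> cells X rs x y q"
      using ccomp1_in[OF \<phi>] t y by fastforce
    show "(\<lambda>\<chi>. ccomp X \<psi> x [\<chi>]) ` cells X rs x y q \<subseteq> cells X rs x y p"
      using ccomp1_in[OF \<psi>] t y by fastforce
  qed
qed

text \<open>Both maps are conjugate to a single map on 2-cells into \<open>C(l,1)\<close>: one
  through its cartesian 2-cell to \<open>C(1,1)\<close>, the other through the isomorphism followed
  by the cartesian 2-cell of \<open>E(j,r)\<close>.\<close>

lemma adjunction_bij:
  assumes l: "l \<in> tights X A C" and j: "j \<in> tights X A E" and r: "r \<in> tights X C E"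
    and iso: "loose_iso X \<phi> (lhom X l (tid X C)) (lhom X j r)"
    and \<nu>: "\<nu> \<in> cells X [p] c f (lid X C)"
  shows "bij_betw (\<lambda>\<alpha>. hmul C \<alpha> \<nu>) (cells X rs l c (lid X C)) (cells X (rs @ [p]) l f (lid X C)) \<longleftrightarrow>
    bij_betw (\<lambda>\<alpha>. hmul E \<alpha> (ccomp X (act r) c [\<nu>])) (cells X rs j (r \<cdot> c) (lid X E))
      (cells X (rs @ [p]) j (r \<cdot> f) (lid X E))"
proof -
  have T: "l \<in> Tight X" "tdom X l = A" "tcod X l = C" "j \<in> Tight X" "tdom X j = A" "tcod X j = E"
    "r \<in> Tight X" "tdom X r = C" "tcod X r = E"
    using l j r by (auto simp: tights_def)
  have O: "A \<in> Obj X" "C \<in> Obj X" "E \<in> Obj X" using T by auto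
  have t: "tid X C \<in> Tight X" "tcod X (tid X C) = C" "tdom X (tid X C) = C" using O by auto
  have c: "c \<in> Tight X" "tcod X c = C" and f: "f \<in> Tight X" "tcod X f = C"
    using cells_frame[OF \<nu>] O by auto
  let ?P = "lhom X l (tid X C)" and ?Q = "lhom X j r"
  let ?hl = "hcell X l (tid X C)" and ?hj = "hcell X j r"
  note hl = hcell_spec[OF T(1) t(1) T(3) t(2)] and hj = hcell_spec[OF T(4,7,6,9)]
  have P: "?P \<in> Loose X" "ldom X ?P = C" "lcod X ?P = A" using T t by auto
  note \<rho> = runitor_spec[OF P]
  have \<phi>: "\<phi> \<in> cells X [?P] (tid X A) (tid X C) ?Q" using iso T by (auto simp: loose_iso_def gcells_def)
  \<comment> \<open>The isomorphism read as a 2-cell from \<open>C(l,1)\<close> to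
    \<open>E(1,1)\<close> with tight-cells \<open>j\<close> and \<open>r\<close>; \<open>bj\<close>
    shows that 2-cells factor through it as through the cartesian 2-cell of
    \<open>E(j,r)\<close>.\<close>
  let ?\<epsilon> = "ccomp X ?hj (tid X A) [\<phi>]"
  have \<epsilon>: "?\<epsilon> \<in> cells X [?P] j r (lid X E)" using ccomp1_in[OF hj(2) \<phi>] T by simp
  \<comment> \<open>The common map: absorb \<open>\<nu>\<close> through the unitor of
    \<open>C(l,1)\<close>.\<close>
  let ?M = "\<lambda>\<chi>. ccomp X (runitor X ?P) (tid X A) [\<chi>, \<nu>]"
  have M: "?M ` cells X rs (tid X A) c ?P \<subseteq> cells X (rs @ [p]) (tid X A) f ?P"
    using ccomp2_in[OF \<rho>(1) _ \<nu>] O f by fastforce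
  have bl: "bij_betw (\<lambda>\<chi>. ccomp X ?hl (tid X A) [\<chi>]) (cells X qs (tid X A) y ?P) (cells X qs l y (lid X C))"
    if "y \<in> Tight X" "tcod X y = C" for qs y
    using cart_bij[OF hl, of "tid X A" y qs] that T O by simp
  have bj: "bij_betw (\<lambda>\<chi>. ccomp X ?\<epsilon> (tid X A) [\<chi>]) (cells X qs (tid X A) y ?P) (cells X qs j (r \<cdot> y) (lid X E))"
    if y: "y \<in> Tight X" "tcod X y = C" for qs y
  proof -
    have "bij_betw (\<lambda>\<chi>. ccomp X ?hj (tid X A) [\<chi>]) (cells X qs (tid X A) y ?Q) (cells X qs j (r \<cdot> y) (lid X E))"
      using cart_bij[OF hj, of "tid X A" y qs] that T O by simp
    then have "bij_betw ((\<lambda>\<chi>. ccomp X ?hj (tid X A) [\<chi>]) \<circ> (\<lambda>\<chi>. ccomp X \<phi> (tid X A) [\<chi>]))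
        (cells X qs (tid X A) y ?P) (cells X qs j (r \<cdot> y) (lid X E))"
      using loose_iso_bij[OF iso, of "tid X A"] O P by (intro bij_betw_trans) auto
    then show ?thesis
      by (rule bij_betw_cong[THEN iffD1, rotated])
        (use ccomp_assoc1[OF hj(2) \<phi> cpaths_single] O in auto)
  qed
  note a = cap1_spec(3,2)[OF T(7-9)]
  have "bij_betw (\<lambda>\<alpha>. hmul C \<alpha> \<nu>) (cells X rs l c (lid X C)) (cells X (rs @ [p]) l f (lid X C)) \<longleftrightarrow>
    bij_betw ?M (cells X rs (tid X A) c ?P) (cells X (rs @ [p]) (tid X A) f ?P)"
  proof (rule bij_betw_conjugate[OF bl[OF c] bl[OF f] M, symmetric])
    show "(\<lambda>\<alpha>. hmul C \<alpha> \<nu>) ` cells X rs l c (lid X C) \<subseteq> cells X (rs @ [p]) l f (lid X C)"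
      using hmul_in[OF O(2) _ \<nu>] by blast
  qed (rule ccomp_runitor_cid[OF hl(2) O(2) _ \<nu>])
  also have "\<dots> \<longleftrightarrow> bij_betw (\<lambda>\<alpha>. hmul E \<alpha> (ccomp X (act r) c [\<nu>])) (cells X rs j (r \<cdot> c) (lid X E))
      (cells X (rs @ [p]) j (r \<cdot> f) (lid X E))"
  proof (rule bij_betw_conjugate[OF bj[OF c] bj[OF f] M])
    show "(\<lambda>\<alpha>. hmul E \<alpha> (ccomp X (act r) c [\<nu>])) ` cells X rs j (r \<cdot> c) (lid X E)
        \<subseteq> cells X (rs @ [p]) j (r \<cdot> f) (lid X E)"
      using hmul_in[OF O(3) _ ccomp1_in[OF a(1) \<nu>]] by blast
  qed (rule ccomp_runitor_ccomp[OF \<epsilon> O(3) a(1) O(2) a(2) _ \<nu>])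
  finally show ?thesis .
qed

lemma right_adjoint_preserves_limit:
  assumes j: "j \<in> tights X A E" and dense: "dense X j" and r: "r \<in> tights X C E"
    and l: "l \<in> tights X A C" and iso: "loose_iso X \<phi> (lhom X l (tid X C)) (lhom X j r)"
    and fC: "tcod X f = C" and lim: "limiting X p f c \<mu>"
  shows "preserves_limit X r p f c \<mu>"
proof -
  have cone: "cone X p f c \<mu>" using lim by (simp add: limiting_def)
  have p: "p \<in> Loose X" and f: "f \<in> Tight X" "tdom X f = ldom X p"
    and c: "c \<in> Tight X" "tdom X c = lcod X p" "tcod X c = C"
    and \<mu>: "\<mu> \<in> cells X [p] (tid X (lcod X p)) (tid X (ldom X p)) (lhom X c f)"
    using cone fC by (auto simp: cone_def tights_def gcells_def)
  have T: "l \<in> Tight X" "tdom X l = A" "tcod X l = C" "j \<in> Tight X" "tdom X j = A" "tcod X j = E"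
    "r \<in> Tight X" "tdom X r = C" "tcod X r = E"
    using l j r by (auto simp: tights_def)
  have O: "C \<in> Obj X" "E \<in> Obj X" using T by auto
  let ?\<nu> = "ccomp X (hcell X c f) (tid X (lcod X p)) [\<mu>]"
  let ?\<mu> = "ccomp X (cap_at X r c f) (tid X (lcod X p)) [\<mu>]"
  note hcf = hcell_spec(2)[OF c(1) f(1) c(3) fC]
  have \<nu>: "?\<nu> \<in> cells X [p] c f (lid X C)" using ccomp1_in[OF hcf \<mu>] c f by simp
  have cap: "cap_at X r c f \<in> cells X [lhom X c f] (tid X (lcod X p)) (tid X (ldom X p)) (lhom X (r \<cdot> c) (r \<cdot> f))"
    using cap_at_spec(1)[OF T(7-9) c(1,3) f(1) fC] T c f fC by (simp add: gcells_def)
  have hr: "hcell X (r \<cdot> c) (r \<cdot> f) \<in> cells X [lhom X (r \<cdot> c) (r \<cdot> f)] (r \<cdot> c) (r \<cdot> f) (lid X E)"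
    using T c f fC by (intro hcell_spec) auto
  note act = cap1_spec(3)[OF T(7-9)]
  \<comment> \<open>The image cone, read in \<open>E(1,1)\<close>, is the image of
    \<open>?\<nu>\<close> under \<open>r\<close>, so \<open>limiting_iff\<close> for it is about
    multiplication by that 2-cell.\<close>
  have act_\<nu>: "ccomp X (act r) c [?\<nu>] = ccomp X (hcell X (r \<cdot> c) (r \<cdot> f)) (tid X (lcod X p)) [?\<mu>]"
  proof -
    have "ccomp X (act r) c [?\<nu>] = ccomp X (ccomp X (act r) c [hcell X c f]) (tid X (lcod X p)) [\<mu>]"
      using ccomp_assoc1[OF act hcf cpaths_single[OF \<mu>]] c p by simp
    also have "\<dots> = ccomp X (ccomp X (hcell X (r \<cdot> c) (r \<cdot> f)) (tid X (lcod X p)) [cap_at X r c f])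
        (tid X (lcod X p)) [\<mu>]"
      using cap_at_spec(2)[OF T(7-9) c(1,3) f(1) fC] c by simp
    also have "\<dots> = ccomp X (hcell X (r \<cdot> c) (r \<cdot> f)) (tid X (lcod X p)) [?\<mu>]"
      using ccomp_assoc1[OF hr cap cpaths_single[OF \<mu>]] p by simp
    finally show ?thesis .
  qed
  have cone': "cone X p (r \<cdot> f) (r \<cdot> c) ?\<mu>"
    using ccomp1_in[OF cap \<mu>] p T c f fC by (simp add: cone_def tights_def gcells_def)
  have limC: "bij_betw (\<lambda>\<alpha>. hmul C \<alpha> ?\<nu>) (cells X rs (tid X C) c (lid X C))
      (cells X (rs @ [p]) (tid X C) f (lid X C))" if "chain X C rs (lcod X p)" for rs
    using that limiting_iff[OF cone fC refl] lim by simp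
  have "bij_betw (\<lambda>\<alpha>. hmul E \<alpha> (ccomp X (act r) c [?\<nu>])) (cells X rs (tid X E) (r \<cdot> c) (lid X E))
      (cells X (rs @ [p]) (tid X E) (r \<cdot> f) (lid X E))"
    if rs: "chain X E rs (lcod X p)" for rs
  proof -
    let ?h = "hcell X j (tid X E)" and ?P = "lhom X j (tid X E)"
    have h: "?h \<in> cells X [?P] j (tid X E) (lid X E)" using T O by (intro hcell_spec) auto
    note a\<nu> = ccomp1_in[OF act \<nu>]
    \<comment> \<open>Prolonging \<open>rs\<close> by \<open>E(j,1)\<close> gives a chain ending at
      \<open>A\<close>, the common domain of \<open>l\<close> and \<open>j\<close>; there the limit
      in \<open>C\<close> can be used with left tight-cell \<open>l\<close>.\<close>
    have "bij_betw (\<lambda>\<alpha>. hmul C \<alpha> ?\<nu>) (cells X (?P # rs) l c (lid X C)) (cells X ((?P # rs) @ [p]) l f (lid X C))"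
      using rs T O by (intro hmul_bij_left[OF O(1) \<nu> limC]) auto
    then have "bij_betw (\<lambda>\<alpha>. hmul E \<alpha> (ccomp X (act r) c [?\<nu>])) (cells X (?P # rs) j (r \<cdot> c) (lid X E))
        (cells X (?P # rs @ [p]) j (r \<cdot> f) (lid X E))"
      unfolding adjunction_bij[OF l j r iso \<nu>] by simp
    \<comment> \<open>Density is used twice, at \<open>r \<cdot> c\<close> for source 2-cells and at
      \<open>r \<cdot> f\<close> for target 2-cells.\<close>
    moreover have "bij_betw (hmul E ?h) (cells X rs (tid X E) (r \<cdot> c) (lid X E))
        (cells X (?P # rs) j (r \<cdot> c) (lid X E))"
      using T c rs by (intro dense_bij[OF T(4,6) dense]) auto
    moreover have "bij_betw (hmul E ?h) (cells X (rs @ [p]) (tid X E) (r \<cdot> f) (lid X E))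
        (cells X (?P # rs @ [p]) j (r \<cdot> f) (lid X E))"
      using T f fC rs p by (intro dense_bij[OF T(4,6) dense]) (auto simp: chain_append)
    moreover have "(\<lambda>\<alpha>. hmul E \<alpha> (ccomp X (act r) c [?\<nu>])) ` cells X rs (tid X E) (r \<cdot> c) (lid X E)
        \<subseteq> cells X (rs @ [p]) (tid X E) (r \<cdot> f) (lid X E)"
      using hmul_in[OF O(2) _ a\<nu>] by blast
    moreover have "(\<lambda>\<alpha>. hmul E \<alpha> (ccomp X (act r) c [?\<nu>])) ` cells X (?P # rs) j (r \<cdot> c) (lid X E)
        \<subseteq> cells X (?P # rs @ [p]) j (r \<cdot> f) (lid X E)"
      using hmul_in[OF O(2) _ a\<nu>] by fastforce
    ultimately show ?thesis
      \<comment> \<open>Associativity makes the square commute: multiplication by \<open>?h\<close>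
        on the left commutes with multiplication on the right.\<close>
      using hmul_assoc[OF O(2) h _ a\<nu>]
      by (subst bij_betw_conjugate[where G = "hmul E ?h" and H = "hmul E ?h"]) auto
  qed
  then have "limiting X p (r \<cdot> f) (r \<cdot> c) ?\<mu>"
    using limiting_iff[OF cone' _ act_\<nu>] T f fC by simp
  then show ?thesis by (simp add: preserves_limit_def)
qed

end

theorem proposition5p12:
  fixes X :: "('o, 't, 'l, 'c) vdc"
  assumes "virtual_equipment X"
    and "j \<in> tights X A E"
    and "dense X j"
    and "r \<in> tights X C E"
    and "right_relative_adjoint X j r"
  shows "preserves_limits X r"
proof -
  interpret virtual_equipment X by fact
  \<comment> \<open>The objects quantified in \<open>relative_adjunction\<close> are determined by
    the frames of \<open>j\<close> and \<open>r\<close>, hence are \<open>A\<close>,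
    \<open>C\<close> and \<open>E\<close>.\<close>
  obtain l \<phi> where "l \<in> tights X A C" and "loose_iso X \<phi> (lhom X l (tid X C)) (lhom X j r)"
    using assms(2,4,5) by (auto simp: right_relative_adjoint_def relative_adjunction_def tights_def)
  then show ?thesis
    using right_adjoint_preserves_limit[OF assms(2-4)] assms(4)
    by (auto simp: preserves_limits_def tights_def)
qed

end
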